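(* Let $\{X_k\}$ be a Gaussian sequence with almost periodic covariance function satisfying Assumptions 1 and 2 (stated in the context). Then, with probability 1, $$\limsup_{n\to\infty}\ \sup_{w}\frac{|V_n(w)|}{(n\log n)^{1/2}}\le 2^{5/2}\,q\left(\sum_{j}c(j)\right),$$ where $q$ is the number of elements of $\mathcal L$ and $c(\cdot)$ is the dominating function of Assumption 2.
   Context: Setting. $\{X_k\}_{k\in\mathbb Z}$ is a real-valued, mean-zero process. It is harmonizable: $X_k=\int_{-\pi}^{\pi}e^{ik\lambda}\,dZ(\lambda)$ in mean square, where the spectral covariance measure $dF(\lambda,\mu)=E\,dZ(\lambda)\overline{dZ(\mu)}$ on $[-\pi,\pi]^2$ has finite total variation. Its covariance function is almost periodic, so $F$ is carried by lines $\lambda=\mu+b$ (mod $2\pi$), and on these lines $F$ has densities $f_b(\mu)$. $\mathcal L\subset(-\pi,\pi]$ is the set of $b$ whose line carries nontrivial spectral mass ($f_b\not\equiv0$). Thus $$r_{k,m}=EX_kX_m=\sum_{b\in\mathcal L}\int_{-\pi}^{\pi}e^{ik(\mu+b)}e^{-im\mu}f_b(\mu)\,d\mu=\sum_{b\in\mathcal L}e^{ikb}c_b(k-m),\qquad c_b(j)=\int_{-\pi}^{\pi}e^{ij\lambda}f_b(\lambda)\,d\lambda .$$ Assumption 1: $\{X_k\}$ is a Gaussian process (in addition to being real-valued, mean-zero and harmonizable with almost periodic covariance function), $\mathcal L$ is finite, and each $f_b$, $b\in\mathcal L$, is continuously differentiable on the torus, i.e. is a complex-valued $2\pi$-periodic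 $C^1$ function. Assumption 2: there is a function $c(j)\ge0$ on $\mathbb Z$ with $|c_b(j)|\le c(j)$ for all $b\in\mathcal L$, $j\in\mathbb Z$, and $\sum_{j\in\mathbb Z}c(j)<\infty$. Notation. $n$ is an even positive integer, $$U_n(w)=\frac1{n+1}\sum_{k=-n/2}^{n/2}X_k^2e^{-iwk},\qquad V_n(w)=(n+1)\{U_n(w)-EU_n(w)\},$$ and $\sup_w$ is over real $w$ (equivalently $w\in[-\pi,\pi]$). *)

theory Defs
  imports "HOL-Probability.Probability" "HOL-Library.Real_Mod"
begin

section \<open>Harmonizable processes\<close>

abbreviation freq :: "real set" where
  "freq \<equiv> {-pi..pi}"

definition borel_subsets :: "'a::topological_space set \<Rightarrow> 'a set set" where
  "borel_subsets \<Omega> = {A \<in> sets borel. A \<subseteq> \<Omega>}"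

definition complex_measure :: "'a::topological_space set \<Rightarrow> ('a set \<Rightarrow> complex) \<Rightarrow> bool" where
  "complex_measure \<Omega> F \<longleftrightarrow> F {} = 0 \<and>
     (\<forall>A :: nat \<Rightarrow> 'a set. range A \<subseteq> borel_subsets \<Omega> \<longrightarrow> disjoint_family A \<longrightarrow>
        (\<lambda>i. F (A i)) sums F (\<Union>i. A i))"

definition finite_total_variation :: "'a::topological_space set \<Rightarrow> ('a set \<Rightarrow> complex) \<Rightarrow> bool" where
  "finite_total_variation \<Omega> F \<longleftrightarrow>
     (\<exists>K. \<forall>P. finite P \<longrightarrow> P \<subseteq> borel_subsets \<Omega> \<longrightarrow> disjoint P \<longrightarrow> (\<Sum>S\<in>P. cmod (F S)) \<le> K)"

text \<open>
  \<open>Z A \<omega>\<close> is the value at the outcome \<open>\<omega>\<close> of the random variable that the stochastic measure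
  assigns to the Borel set \<open>A\<close>. The last conjunct is the relation
  \<open>dF(\<lambda>,\<mu>) = E dZ(\<lambda>) cnj (dZ(\<mu>))\<close>.
\<close>

definition random_measure ::
    "'w measure \<Rightarrow> (real set \<Rightarrow> 'w \<Rightarrow> complex) \<Rightarrow> ((real \<times> real) set \<Rightarrow> complex) \<Rightarrow> bool" where
  "random_measure M Z F \<longleftrightarrow>
     (\<forall>A \<in> borel_subsets freq.
        Z A \<in> borel_measurable M \<and> integrable M (\<lambda>\<omega>. (cmod (Z A \<omega>))\<^sup>2)) \<and>
     (\<forall>A \<in> borel_subsets freq. \<forall>B \<in> borel_subsets freq. A \<inter> B = {} \<longrightarrow>
        (AE \<omega> in M. Z (A \<union> B) \<omega> = Z A \<omega> + Z B \<omega>)) \<and>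
     (\<forall>A \<in> borel_subsets freq. \<forall>B \<in> borel_subsets freq.
        (\<integral>\<omega>. Z A \<omega> * cnj (Z B \<omega>) \<partial>M) = F (A \<times> B))"

definition simple_stochastic_integral ::
    "(real set \<Rightarrow> 'w \<Rightarrow> complex) \<Rightarrow> (real \<Rightarrow> complex) \<Rightarrow> 'w \<Rightarrow> complex" where
  "simple_stochastic_integral Z s \<omega> = (\<Sum>v \<in> s ` freq. v * Z {x \<in> freq. s x = v} \<omega>)"

text \<open>
  The mean-square integral \<open>Y = \<integral> g dZ\<close> of a bounded function. When the spectral covariance
  measure has finite total variation, it does not depend (up to null sets) on the approximating
  sequence of simple functions.
\<close>

definition has_stochastic_integral ::
    "'w measure \<Rightarrow> (real set \<Rightarrow> 'w \<Rightarrow> complex) \<Rightarrow> (real \<Rightarrow> complex) \<Rightarrow> ('w \<Rightarrow> complex) \<Rightarrow> bool" where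
  "has_stochastic_integral M Z g Y \<longleftrightarrow>
     (\<exists>s :: nat \<Rightarrow> real \<Rightarrow> complex.
        (\<forall>n. simple_function borel (s n)) \<and> uniform_limit freq s g sequentially \<and>
        (\<lambda>n. \<integral>\<omega>. (cmod (Y \<omega> - simple_stochastic_integral Z (s n) \<omega>))\<^sup>2 \<partial>M) \<longlonglongrightarrow> 0)"

definition harmonizable ::
    "'w measure \<Rightarrow> (int \<Rightarrow> 'w \<Rightarrow> real) \<Rightarrow> ((real \<times> real) set \<Rightarrow> complex) \<Rightarrow> bool" where
  "harmonizable M X F \<longleftrightarrow>
     (\<forall>k. X k \<in> borel_measurable M \<and> integrable M (\<lambda>\<omega>. (X k \<omega>)\<^sup>2)) \<and>
     complex_measure (freq \<times> freq) F \<and> finite_total_variation (freq \<times> freq) F \<and>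
     (\<exists>Z. random_measure M Z F \<and>
        (\<forall>k. has_stochastic_integral M Z (\<lambda>t. exp (\<i> * of_int k * of_real t))
               (\<lambda>\<omega>. of_real (X k \<omega>))))"

definition mean_zero :: "'w measure \<Rightarrow> (int \<Rightarrow> 'w \<Rightarrow> real) \<Rightarrow> bool" where
  "mean_zero M X \<longleftrightarrow> (\<forall>k. integrable M (X k) \<and> (\<integral>\<omega>. X k \<omega> \<partial>M) = 0)"


section \<open>Almost periodic covariance and spectral densities\<close>

definition covariance :: "'w measure \<Rightarrow> (int \<Rightarrow> 'w \<Rightarrow> real) \<Rightarrow> int \<Rightarrow> int \<Rightarrow> real" where
  "covariance M X k m = (\<integral>\<omega>. X k \<omega> * X m \<omega> \<partial>M)"

text \<open>Bohr's definition: for each \<open>\<epsilon>\<close>, the \<open>\<epsilon>\<close>-almost periods are relatively dense.\<close>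

definition almost_periodic :: "(int \<Rightarrow> real) \<Rightarrow> bool" where
  "almost_periodic g \<longleftrightarrow>
     (\<forall>\<epsilon>>0. \<exists>N::nat. \<forall>a::int. \<exists>p \<in> {a..a + int N}. \<forall>k. \<bar>g (k + p) - g k\<bar> < \<epsilon>)"

definition almost_periodic_covariance :: "'w measure \<Rightarrow> (int \<Rightarrow> 'w \<Rightarrow> real) \<Rightarrow> bool" where
  "almost_periodic_covariance M X \<longleftrightarrow>
     (\<forall>j. almost_periodic (\<lambda>k. covariance M X (k + j) k))"

text \<open>The representative of \<open>x\<close> modulo \<open>2\<pi>\<close> in the interval \<open>(-\<pi>, \<pi>]\<close>.\<close>

definition wrap :: "real \<Rightarrow> real" where
  "wrap x = pi - ((pi - x) rmod (2 * pi))"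

text \<open>The set written \<open>\<L>\<close> in the literature; \<open>f b\<close> is the density on the line \<open>\<lambda> = \<mu> + b\<close>.\<close>

definition spectral_lines :: "(real \<Rightarrow> real \<Rightarrow> complex) \<Rightarrow> real set" where
  "spectral_lines f = {b \<in> {-pi<..pi}. \<exists>\<mu>. f b \<mu> \<noteq> 0}"

text \<open>
  \<open>F\<close> is carried by the lines \<open>\<lambda> = \<mu> + b\<close> (mod \<open>2\<pi>\<close>), \<open>-\<pi> < b \<le> \<pi>\<close>, with densities \<open>f b\<close>
  with respect to \<open>d\<mu>\<close>.
\<close>

definition has_line_densities ::
    "((real \<times> real) set \<Rightarrow> complex) \<Rightarrow> (real \<Rightarrow> real \<Rightarrow> complex) \<Rightarrow> bool" where
  "has_line_densities F f \<longleftrightarrow>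
     (\<forall>b \<in> spectral_lines f. set_integrable lborel freq (f b)) \<and>
     (\<forall>S \<in> borel_subsets (freq \<times> freq).
        ((\<lambda>b. LINT \<mu>:freq|lborel. indicator S (wrap (\<mu> + b), \<mu>) * f b \<mu>) has_sum F S)
          (spectral_lines f))"

definition line_coeff :: "(real \<Rightarrow> real \<Rightarrow> complex) \<Rightarrow> real \<Rightarrow> int \<Rightarrow> complex" where
  "line_coeff f b j = (LINT t:freq|lborel. exp (\<i> * of_int j * of_real t) * f b t)"

definition C1_on_torus :: "(real \<Rightarrow> complex) \<Rightarrow> bool" where
  "C1_on_torus g \<longleftrightarrow> (\<forall>x. g (x + 2 * pi) = g x) \<and> g C1_differentiable_on UNIV"


section \<open>Gaussian processes\<close>

text \<open>Constants are included, as the degenerate normal distributions.\<close>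

definition gaussian_rv :: "'w measure \<Rightarrow> ('w \<Rightarrow> real) \<Rightarrow> bool" where
  "gaussian_rv M Y \<longleftrightarrow> Y \<in> borel_measurable M \<and>
     (\<exists>m. distr M borel Y = return borel m \<or>
          (\<exists>\<sigma>>0. distr M borel Y = density lborel (normal_density m \<sigma>)))"

definition gaussian_process :: "'w measure \<Rightarrow> (int \<Rightarrow> 'w \<Rightarrow> real) \<Rightarrow> bool" where
  "gaussian_process M X \<longleftrightarrow>
     (\<forall>I (a :: int \<Rightarrow> real). finite I \<longrightarrow> gaussian_rv M (\<lambda>\<omega>. \<Sum>k\<in>I. a k * X k \<omega>))"


section \<open>The statistics\<close>

definition U :: "(int \<Rightarrow> 'w \<Rightarrow> real) \<Rightarrow> nat \<Rightarrow> real \<Rightarrow> 'w \<Rightarrow> complex" where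
  "U X n w \<omega> = 1 / of_nat (n + 1) *
     (\<Sum>k = - (int n div 2)..int n div 2. of_real ((X k \<omega>)\<^sup>2) * exp (- \<i> * of_real w * of_int k))"

definition V :: "'w measure \<Rightarrow> (int \<Rightarrow> 'w \<Rightarrow> real) \<Rightarrow> nat \<Rightarrow> real \<Rightarrow> 'w \<Rightarrow> complex" where
  "V M X n w \<omega> = of_nat (n + 1) * (U X n w \<omega> - (\<integral>\<omega>'. U X n w \<omega>' \<partial>M))"

end

theory Submission
  imports Defs "HOL-Real_Asymp.Real_Asymp"
begin

text \<open>
  Write \<open>r\<close> for the covariance and \<open>\<xi>\<^sub>k = X\<^sub>k\<^sup>2 - r\<^sub>k\<^sub>k\<close>, so that \<open>V\<^sub>n(w)\<close> is a trigonometric sum of the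
  \<open>\<xi>\<^sub>k\<close>, \<open>\<bar>k\<bar> \<le> n/2\<close>. The spectral representation gives \<open>r\<^sub>k\<^sub>m = \<Sum>\<^sub>b e\<^bsup>ikb\<^esup> c\<^sub>b(k - m)\<close>
  (\<open>covariance_eq_sum_line_coeff\<close>), hence every row of the covariance matrix has absolute sum at
  most \<open>S = q \<Sum>\<^sub>j c(j)\<close> (\<open>covariance_row_sum_le\<close>). This row bound controls the
  dependence. Fix \<open>\<sigma> > 0\<close> with \<open>\<sigma> \<ge> S\<close>.

  For real weights \<open>\<bar>a\<^sub>k\<bar> \<le> 1\<close> the cumulant expansion of a Gaussian quadratic form reads
  \<open>log E exp (\<theta> \<Sum> a\<^sub>k \<xi>\<^sub>k) = \<theta>\<^sup>2 \<Sum>\<^sub>k\<^sub>m a\<^sub>k a\<^sub>m r\<^sub>k\<^sub>m\<^sup>2 + O(n (\<theta> \<sigma>)\<^sup>3)\<close>, and the row bound makes the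
  quadratic term at most \<open>(n + 1) (\<theta> \<sigma>)\<^sup>2\<close>. With \<open>x = 4 \<sigma> (n log n)\<^bsup>1/2\<^esup>\<close> and
  \<open>\<theta> = 2 (log n / n)\<^bsup>1/2\<^esup> / \<sigma>\<close>, Chernoff's inequality bounds \<open>P(\<Sum> a\<^sub>k \<xi>\<^sub>k \<ge> x)\<close> by a
  constant times \<open>n\<^bsup>-4\<^esup>\<close> (\<open>gaussian_squares_tail\<close>, \<open>chernoff_exponent_eventually\<close>). A grid of
  \<open>L n\<^sup>2\<close> frequencies resolves \<open>V\<^sub>n\<close>: bounds by \<open>x\<close> on the real and imaginary parts over the grid and
  on each \<open>\<bar>\<xi>\<^sub>k\<bar>\<close> give \<open>\<bar>V\<^sub>n(w)\<bar> \<le> (\<surd>2 + 5/L) x\<close> for all \<open>w\<close> (\<open>trig_sum_le_on_grid\<close>). The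
  corresponding union bound is of order \<open>n\<^bsup>-2\<^esup>\<close>, which is summable, so Borel--Cantelli yields the
  limsup bound \<open>4 (\<surd>2 + 5/L) \<sigma>\<close>. Letting \<open>L \<rightarrow> \<infinity>\<close> and \<open>\<sigma> \<rightarrow> S\<close> gives \<open>4 \<surd>2 S = 2\<^bsup>5/2\<^esup> S\<close>.

  The cumulant bound is proved from one-dimensional Gaussian laws only. Multiplying the law by
  \<open>exp (d X\<^sub>k\<^sup>2)\<close> for one \<open>k\<close> at a time keeps it Gaussian up to a constant: the covariance matrix
  \<open>R\<close> receives a rank-one correction and the total mass the factor \<open>(1 - 2 d R\<^sub>k\<^sub>k)\<^bsup>-1/2\<^esup>\<close>. The reason
  is that \<open>exp (d X\<^sub>k\<^sup>2)\<close> is a Gaussian mixture of exponentials of \<open>X\<^sub>k\<close>, real ones for \<open>d \<ge> 0\<close>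
  and imaginary ones for \<open>d \<le> 0\<close>. Hence negative weights are processed first, on characteristic
  functions (\<open>char_rank_one_tilt\<close>); then Levy's uniqueness theorem, applied to each linear form,
  converts to moment generating functions (\<open>gaussian_char_imp_mgf\<close>); and the positive weights follow
  (\<open>mgf_rank_one_tilt\<close>). The tilted covariances satisfy a resolvent identity, which keeps them close
  to the original one and turns the product of the mass factors into the cumulant expansion
  (\<open>nn_integral_exp_weighted_squares_le\<close>).
\<close>

section \<open>Gaussian tilts by the square of one coordinate\<close>

lemma nn_integral_normal_density: "0 < \<sigma> \<Longrightarrow> (\<integral>\<^sup>+x. ennreal (normal_density m \<sigma> x) \<partial>lborel) = 1"
  by (subst nn_integral_eq_integral) (auto simp: integral_normal_density)

text \<open>
  Completing the square turns the integrand into a multiple of the normal density with mean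
  \<open>s / (1 - 2 e)\<close> and variance \<open>1 / (1 - 2 e)\<close>.
\<close>

lemma nn_integral_exp_quadratic_std_normal:
  assumes e: "2 * e < 1"
  shows "(\<integral>\<^sup>+x. ennreal (exp (s * x + e * x\<^sup>2)) \<partial>std_normal_distribution)
    = ennreal (exp (s\<^sup>2 / (2 * (1 - 2 * e))) / sqrt (1 - 2 * e))"
proof -
  define v where "v = 1 - 2 * e"
  have v: "v > 0" using e by (simp add: v_def)
  have eq: "std_normal_density x * exp (s * x + e * x\<^sup>2)
      = exp (s\<^sup>2 / (2 * v)) / sqrt v * normal_density (s / v) (1 / sqrt v) x" for x
  proof -
    have "- x\<^sup>2 / 2 + (s * x + e * x\<^sup>2) = s\<^sup>2 / (2 * v) + - (x - s / v)\<^sup>2 / (2 * (1 / sqrt v)\<^sup>2)"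
    proof -
      have "(x - s / v)\<^sup>2 / (2 * (1 / sqrt v)\<^sup>2) = v * (x - s / v)\<^sup>2 / 2"
        using v by (simp add: power_divide)
      also have "\<dots> = (x\<^sup>2 * v - 2 * x * s + s\<^sup>2 / v) / 2"
        using v by (simp add: field_simps power2_eq_square)
      also have "\<dots> = x\<^sup>2 / 2 - e * x\<^sup>2 - x * s + s\<^sup>2 / (2 * v)"
        by (simp add: v_def algebra_simps diff_divide_distrib add_divide_distrib)
      finally show ?thesis by (simp add: algebra_simps)
    qed
    then have "exp (- x\<^sup>2 / 2) * exp (s * x + e * x\<^sup>2)
        = exp (s\<^sup>2 / (2 * v)) * exp (- (x - s / v)\<^sup>2 / (2 * (1 / sqrt v)\<^sup>2))"
      by (simp only: exp_add[symmetric])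
    moreover have "1 / sqrt (2 * pi) = 1 / sqrt v * (1 / sqrt (2 * pi * (1 / sqrt v)\<^sup>2))"
      using v by (simp add: real_sqrt_mult real_sqrt_divide power_divide)
    ultimately show ?thesis
      unfolding std_normal_density_def normal_density_def by (simp add: mult.assoc)
  qed
  have "(\<integral>\<^sup>+x. ennreal (exp (s * x + e * x\<^sup>2)) \<partial>std_normal_distribution)
      = (\<integral>\<^sup>+x. ennreal (std_normal_density x) * ennreal (exp (s * x + e * x\<^sup>2)) \<partial>lborel)"
    by (subst nn_integral_density) auto
  also have "\<dots> = (\<integral>\<^sup>+x. ennreal (exp (s\<^sup>2 / (2 * v)) / sqrt v)
      * ennreal (normal_density (s / v) (1 / sqrt v) x) \<partial>lborel)"
    using v by (intro nn_integral_cong) (simp add: ennreal_mult[symmetric] eq)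
  also have "\<dots> = ennreal (exp (s\<^sup>2 / (2 * v)) / sqrt v)"
    using v by (subst nn_integral_cmult) (auto simp: nn_integral_normal_density)
  finally show ?thesis by (simp add: v_def)
qed

lemma has_bochner_integral_exp_quadratic_std_normal:
  assumes e: "2 * e < 1"
  shows "has_bochner_integral std_normal_distribution (\<lambda>x. exp (s * x + e * x\<^sup>2))
    (exp (s\<^sup>2 / (2 * (1 - 2 * e))) / sqrt (1 - 2 * e))"
  using e by (intro has_bochner_integral_nn_integral)
    (auto simp: nn_integral_exp_quadratic_std_normal)

definition quad_form :: "'i set \<Rightarrow> ('i \<Rightarrow> 'i \<Rightarrow> real) \<Rightarrow> ('i \<Rightarrow> real) \<Rightarrow> real" where
  "quad_form I R t = (\<Sum>i\<in>I. \<Sum>j\<in>I. t i * R i j * t j)"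

definition rank_one_update :: "real \<Rightarrow> 'i \<Rightarrow> ('i \<Rightarrow> 'i \<Rightarrow> real) \<Rightarrow> 'i \<Rightarrow> 'i \<Rightarrow> real" where
  "rank_one_update d k R = (\<lambda>i j. R i j + 2 * d * R i k * R k j / (1 - 2 * d * R k k))"

lemma quad_form_shift:
  assumes I: "finite I" "k \<in> I" and sym: "\<And>i j. R i j = R j i"
  shows "quad_form I R (t(k := t k + s))
    = quad_form I R t + 2 * s * (\<Sum>j\<in>I. R k j * t j) + s\<^sup>2 * R k k"
proof -
  define \<delta> :: "'a \<Rightarrow> real" where "\<delta> i = of_bool (i = k)" for i
  have upd: "t(k := t k + s) = (\<lambda>i. t i + s * \<delta> i)"
    by (auto simp: \<delta>_def fun_eq_iff)
  have pick: "(\<Sum>j\<in>I. \<delta> j * g j) = g k" for g :: "'a \<Rightarrow> real"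
    using I by (simp add: \<delta>_def sum.remove[of I k])
  have col: "(\<Sum>i\<in>I. t i * R i k) = (\<Sum>j\<in>I. R k j * t j)"
    using sym by (intro sum.cong) (auto simp: mult.commute)
  have "quad_form I R (t(k := t k + s)) = quad_form I R t
      + s * (\<Sum>i\<in>I. t i * (\<Sum>j\<in>I. \<delta> j * R i j)) + s * (\<Sum>i\<in>I. \<delta> i * (\<Sum>j\<in>I. R i j * t j))
      + s\<^sup>2 * (\<Sum>i\<in>I. \<delta> i * (\<Sum>j\<in>I. \<delta> j * R i j))"
    unfolding quad_form_def upd
    by (simp add: algebra_simps sum.distrib sum_distrib_left power2_eq_square)
  then show ?thesis
    unfolding pick using col by simp
qed

lemma quad_form_rank_one_update:
  assumes sym: "\<And>i j. R i j = R j i"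
  shows "quad_form I (rank_one_update d k R) t
    = quad_form I R t + 2 * d * (\<Sum>j\<in>I. R k j * t j)\<^sup>2 / (1 - 2 * d * R k k)"
proof -
  define u where "u = (\<Sum>j\<in>I. R k j * t j)"
  have u': "u = (\<Sum>i\<in>I. t i * R i k)"
    unfolding u_def using sym by (intro sum.cong) (auto simp: mult.commute)
  have "quad_form I (rank_one_update d k R) t
      = quad_form I R t + (\<Sum>i\<in>I. \<Sum>j\<in>I. (2 * d / (1 - 2 * d * R k k)) * ((t i * R i k) * (R k j * t j)))"
    unfolding quad_form_def rank_one_update_def
    by (simp add: ring_distribs sum.distrib mult_ac)
  also have "(\<Sum>i\<in>I. \<Sum>j\<in>I. (2 * d / (1 - 2 * d * R k k)) * ((t i * R i k) * (R k j * t j)))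
      = (2 * d / (1 - 2 * d * R k k)) * (u * u)"
  proof -
    have "u * u = (\<Sum>i\<in>I. t i * R i k) * (\<Sum>j\<in>I. R k j * t j)"
      using u' u_def by simp
    also have "\<dots> = (\<Sum>i\<in>I. \<Sum>j\<in>I. (t i * R i k) * (R k j * t j))"
      by (rule sum_product)
    finally show ?thesis by (simp only: sum_distrib_left)
  qed
  finally show ?thesis by (simp add: u_def power2_eq_square)
qed

lemma sum_fun_upd_shift:
  fixes t x :: "'i \<Rightarrow> real"
  assumes "finite I" "k \<in> I"
  shows "(\<Sum>i\<in>I. (t(k := t k + s)) i * x i) = (\<Sum>i\<in>I. t i * x i) + s * x k"
  using assms by (simp add: sum.remove[of I k] algebra_simps)

lemma prob_space_std_normal: "prob_space std_normal_distribution"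
  using real_dist_normal_dist by (simp add: real_distribution_def)

text \<open>
  The hypothesis says that the measure with density \<open>W\<close> is \<open>C\<close> times a centred Gaussian law with
  covariance \<open>R\<close>, as far as its moment generating function on the coordinates in \<open>I\<close> can tell. Since
  \<open>exp (d x\<^sup>2) = E exp (\<surd>(2 d) g x)\<close> for a standard normal \<open>g\<close>, tilting by \<open>exp (d X\<^sub>k\<^sup>2)\<close> amounts
  to averaging the known function over shifts of the argument \<open>t\<close> in direction \<open>k\<close>. That average is
  again a one-dimensional Gaussian integral.
\<close>

lemma (in prob_space) mgf_rank_one_tilt:
  fixes X :: "'i \<Rightarrow> 'a \<Rightarrow> real" and W :: "'a \<Rightarrow> real"
  assumes X [measurable]: "\<And>i. X i \<in> borel_measurable M"
    and W [measurable]: "W \<in> borel_measurable M" "\<And>\<omega>. 0 \<le> W \<omega>"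
    and C: "0 \<le> C"
    and I: "finite I" "k \<in> I" and sym: "\<And>i j. R i j = R j i"
    and d: "0 \<le> d" "2 * d * R k k < 1"
    and mgf: "\<And>t. (\<integral>\<^sup>+\<omega>. ennreal (W \<omega> * exp (\<Sum>i\<in>I. t i * X i \<omega>)) \<partial>M)
      = ennreal (C * exp (quad_form I R t / 2))"
  shows "(\<integral>\<^sup>+\<omega>. ennreal (W \<omega> * exp (d * (X k \<omega>)\<^sup>2) * exp (\<Sum>i\<in>I. t i * X i \<omega>)) \<partial>M)
    = ennreal (C / sqrt (1 - 2 * d * R k k) * exp (quad_form I (rank_one_update d k R) t / 2))"
proof -
  let ?N = std_normal_distribution
  interpret N: prob_space ?N by (rule prob_space_std_normal)
  interpret MN: pair_sigma_finite M ?N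
    by unfold_locales
  define a where "a = sqrt (2 * d)"
  have a: "a\<^sup>2 = 2 * d" using d by (simp add: a_def)
  define u where "u = (\<Sum>j\<in>I. R k j * t j)"
  have split: "ennreal (W \<omega> * exp (d * (X k \<omega>)\<^sup>2) * exp (\<Sum>i\<in>I. t i * X i \<omega>))
      = (\<integral>\<^sup>+g. ennreal (W \<omega> * exp ((\<Sum>i\<in>I. t i * X i \<omega>) + a * g * X k \<omega>)) \<partial>?N)" for \<omega>
  proof -
    have "(\<integral>\<^sup>+g. ennreal (W \<omega> * exp ((\<Sum>i\<in>I. t i * X i \<omega>) + a * g * X k \<omega>)) \<partial>?N)
        = (\<integral>\<^sup>+g. ennreal (W \<omega> * exp (\<Sum>i\<in>I. t i * X i \<omega>))
            * ennreal (exp ((a * X k \<omega>) * g + 0 * g\<^sup>2)) \<partial>?N)"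
      using W by (intro nn_integral_cong) (simp add: ennreal_mult[symmetric] exp_add mult_ac)
    also have "\<dots> = ennreal (W \<omega> * exp (\<Sum>i\<in>I. t i * X i \<omega>))
        * ennreal (exp ((a * X k \<omega>)\<^sup>2 / 2))"
      by (subst nn_integral_cmult, simp, subst nn_integral_exp_quadratic_std_normal) simp_all
    also have "(a * X k \<omega>)\<^sup>2 / 2 = d * (X k \<omega>)\<^sup>2"
      by (simp add: power_mult_distrib a)
    finally show ?thesis
      using W by (simp add: ennreal_mult[symmetric] mult_ac)
  qed
  have lin: "(\<Sum>i\<in>I. t i * X i \<omega>) + a * g * X k \<omega> = (\<Sum>i\<in>I. (t(k := t k + a * g)) i * X i \<omega>)" for g \<omega>
    by (rule sum_fun_upd_shift[OF I, symmetric])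
  have inner: "(\<integral>\<^sup>+\<omega>. ennreal (W \<omega> * exp ((\<Sum>i\<in>I. t i * X i \<omega>) + a * g * X k \<omega>)) \<partial>M)
      = ennreal (C * exp (quad_form I R t / 2)) * ennreal (exp ((a * u) * g + (d * R k k) * g\<^sup>2))" for g
  proof -
    have "(\<integral>\<^sup>+\<omega>. ennreal (W \<omega> * exp ((\<Sum>i\<in>I. t i * X i \<omega>) + a * g * X k \<omega>)) \<partial>M)
        = ennreal (C * exp (quad_form I R (t(k := t k + a * g)) / 2))"
      unfolding mgf[symmetric] lin by (rule refl)
    also have "quad_form I R (t(k := t k + a * g)) / 2
        = quad_form I R t / 2 + ((a * u) * g + (d * R k k) * g\<^sup>2)"
      unfolding quad_form_shift[where t = t and s = "a * g", OF I sym] u_def[symmetric]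
      by (simp add: power_mult_distrib a add_divide_distrib)
    finally show ?thesis
      using C by (simp add: exp_add ennreal_mult[symmetric] mult_ac)
  qed
  have "(\<integral>\<^sup>+\<omega>. ennreal (W \<omega> * exp (d * (X k \<omega>)\<^sup>2) * exp (\<Sum>i\<in>I. t i * X i \<omega>)) \<partial>M)
      = (\<integral>\<^sup>+\<omega>. (\<integral>\<^sup>+g. ennreal (W \<omega> * exp ((\<Sum>i\<in>I. t i * X i \<omega>) + a * g * X k \<omega>)) \<partial>?N) \<partial>M)"
    by (simp add: split)
  also have "\<dots> = (\<integral>\<^sup>+g. (\<integral>\<^sup>+\<omega>. ennreal (W \<omega> * exp ((\<Sum>i\<in>I. t i * X i \<omega>) + a * g * X k \<omega>)) \<partial>M) \<partial>?N)"
    by (intro MN.Fubini'[symmetric]) simp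
  also have "\<dots> = ennreal (C * exp (quad_form I R t / 2))
      * ennreal (exp ((a * u)\<^sup>2 / (2 * (1 - 2 * (d * R k k)))) / sqrt (1 - 2 * (d * R k k)))"
    unfolding inner using d
    by (subst nn_integral_cmult, simp, subst nn_integral_exp_quadratic_std_normal) simp_all
  also have "\<dots> = ennreal (C / sqrt (1 - 2 * d * R k k)
      * (exp (quad_form I R t / 2) * exp ((a * u)\<^sup>2 / (2 * (1 - 2 * d * R k k)))))"
    using C d by (subst ennreal_mult[symmetric]) (simp_all add: mult_ac)
  also have "exp (quad_form I R t / 2) * exp ((a * u)\<^sup>2 / (2 * (1 - 2 * d * R k k)))
      = exp (quad_form I (rank_one_update d k R) t / 2)"
    unfolding quad_form_rank_one_update[OF sym] u_def[symmetric] exp_add[symmetric]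
    by (simp add: power_mult_distrib a add_divide_distrib mult_ac)
  finally show ?thesis .
qed

text \<open>
  For \<open>d \<le> 0\<close> the mixture \<open>exp (d x\<^sup>2) = E exp (i \<surd>(- 2 d) g x)\<close> has imaginary exponents. A shift of
  a characteristic function by a real multiple of \<open>g\<close> absorbs them, whereas a moment generating
  function would have to be continued to complex arguments.
\<close>

lemma (in prob_space) char_rank_one_tilt:
  fixes X :: "'i \<Rightarrow> 'a \<Rightarrow> real" and W :: "'a \<Rightarrow> real"
  assumes X [measurable]: "\<And>i. X i \<in> borel_measurable M"
    and W [measurable]: "W \<in> borel_measurable M" "\<And>\<omega>. 0 \<le> W \<omega>" "\<And>\<omega>. W \<omega> \<le> 1"
    and I: "finite I" "k \<in> I" and sym: "\<And>i j. R i j = R j i"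
    and d: "d \<le> 0" "2 * d * R k k < 1"
    and char: "\<And>t. (CLINT \<omega>|M. of_real (W \<omega>) * iexp (\<Sum>i\<in>I. t i * X i \<omega>))
      = of_real (C * exp (- quad_form I R t / 2))"
  shows "(CLINT \<omega>|M. of_real (W \<omega> * exp (d * (X k \<omega>)\<^sup>2)) * iexp (\<Sum>i\<in>I. t i * X i \<omega>))
    = of_real (C / sqrt (1 - 2 * d * R k k) * exp (- quad_form I (rank_one_update d k R) t / 2))"
proof -
  let ?N = std_normal_distribution
  interpret N: prob_space ?N by (rule prob_space_std_normal)
  interpret MN: pair_prob_space M ?N ..
  define a where "a = sqrt (- (2 * d))"
  have a: "a\<^sup>2 = - (2 * d)" using d by (simp add: a_def)
  define u where "u = (\<Sum>j\<in>I. R k j * t j)"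
  define h where "h \<omega> g = of_real (W \<omega>) * iexp ((\<Sum>i\<in>I. t i * X i \<omega>) + a * g * X k \<omega>)" for \<omega> g
  have split: "of_real (W \<omega> * exp (d * (X k \<omega>)\<^sup>2)) * iexp (\<Sum>i\<in>I. t i * X i \<omega>)
      = (CLINT g|?N. h \<omega> g)" for \<omega>
  proof -
    have "(CLINT g|?N. h \<omega> g) = (CLINT g|?N. of_real (W \<omega>) * iexp (\<Sum>i\<in>I. t i * X i \<omega>)
            * iexp ((a * X k \<omega>) * g))"
      unfolding h_def
      by (intro Bochner_Integration.integral_cong refl) (simp add: exp_add[symmetric] algebra_simps)
    also have "\<dots> = of_real (W \<omega>) * iexp (\<Sum>i\<in>I. t i * X i \<omega>) * char ?N (a * X k \<omega>)"
      unfolding char_def by (rule integral_mult_right_zero)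
    also have "char ?N (a * X k \<omega>) = of_real (exp (d * (X k \<omega>)\<^sup>2))"
      unfolding char_std_normal_distribution by (simp add: power_mult_distrib a)
    finally show ?thesis by (simp add: mult_ac)
  qed
  have lin: "(\<Sum>i\<in>I. t i * X i \<omega>) + a * g * X k \<omega> = (\<Sum>i\<in>I. (t(k := t k + a * g)) i * X i \<omega>)" for g \<omega>
    by (rule sum_fun_upd_shift[OF I, symmetric])
  have inner: "(CLINT \<omega>|M. h \<omega> g) = of_real (C * exp (- quad_form I R t / 2))
      * of_real (exp (- (a * u) * g + (d * R k k) * g\<^sup>2))" for g
  proof -
    have "(CLINT \<omega>|M. h \<omega> g) = of_real (C * exp (- quad_form I R (t(k := t k + a * g)) / 2))"
      unfolding char[symmetric] h_def lin by (rule refl)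
    also have "- quad_form I R (t(k := t k + a * g)) / 2
        = - quad_form I R t / 2 + (- (a * u) * g + (d * R k k) * g\<^sup>2)"
      unfolding quad_form_shift[where t = t and s = "a * g", OF I sym] u_def[symmetric]
      by (simp add: power_mult_distrib a add_divide_distrib diff_divide_distrib)
    finally show ?thesis
      by (simp only: exp_add of_real_mult mult.assoc)
  qed
  have "(CLINT \<omega>|M. of_real (W \<omega> * exp (d * (X k \<omega>)\<^sup>2)) * iexp (\<Sum>i\<in>I. t i * X i \<omega>))
      = (CLINT \<omega>|M. (CLINT g|?N. h \<omega> g))"
    by (simp only: split)
  also have "\<dots> = (CLINT g|?N. (CLINT \<omega>|M. h \<omega> g))"
  proof (rule MN.Fubini_integral[symmetric])
    have "case_prod h \<in> borel_measurable (M \<Otimes>\<^sub>M ?N)"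
      unfolding h_def case_prod_beta by measurable
    then show "integrable (M \<Otimes>\<^sub>M ?N) (case_prod h)"
      using W by (intro MN.integrable_const_bound[where B = 1])
        (auto simp: h_def norm_mult norm_exp_i_times)
  qed
  also have "\<dots> = of_real (C * exp (- quad_form I R t / 2))
      * of_real (LINT g|?N. exp (- (a * u) * g + (d * R k k) * g\<^sup>2))"
    unfolding inner by (simp only: integral_mult_right_zero integral_complex_of_real)
  also have "(LINT g|?N. exp (- (a * u) * g + (d * R k k) * g\<^sup>2))
      = exp ((a * u)\<^sup>2 / (2 * (1 - 2 * d * R k k))) / sqrt (1 - 2 * d * R k k)"
    using d has_bochner_integral_exp_quadratic_std_normal[of "d * R k k" "- (a * u)"]
    by (simp add: has_bochner_integral_iff mult.assoc)
  also have "of_real (C * exp (- quad_form I R t / 2))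
      * of_real (exp ((a * u)\<^sup>2 / (2 * (1 - 2 * d * R k k))) / sqrt (1 - 2 * d * R k k))
      = complex_of_real (C / sqrt (1 - 2 * d * R k k)
        * (exp (- quad_form I R t / 2) * exp ((a * u)\<^sup>2 / (2 * (1 - 2 * d * R k k)))))"
    by simp
  also have "exp (- quad_form I R t / 2) * exp ((a * u)\<^sup>2 / (2 * (1 - 2 * d * R k k)))
      = exp (- quad_form I (rank_one_update d k R) t / 2)"
    unfolding quad_form_rank_one_update[OF sym] u_def[symmetric] exp_add[symmetric]
    by (simp add: power_mult_distrib a add_divide_distrib diff_divide_distrib mult_ac)
  finally show ?thesis .
qed

text \<open>
  The passage from negative to positive weights. After normalisation by \<open>C\<close>, each linear form has
  a Gaussian characteristic function under the measure with density \<open>W\<close>, hence by uniqueness a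
  normal law, whose moment generating function is known. That the quadratic form is nonnegative
  follows from the bound \<open>1\<close> on characteristic functions.
\<close>

lemma (in prob_space) gaussian_char_imp_mgf:
  fixes X :: "'i \<Rightarrow> 'a \<Rightarrow> real" and W :: "'a \<Rightarrow> real"
  assumes X [measurable]: "\<And>i. X i \<in> borel_measurable M"
    and W [measurable]: "W \<in> borel_measurable M" "\<And>\<omega>. 0 \<le> W \<omega>" "\<And>\<omega>. W \<omega> \<le> 1"
    and C: "0 < C"
    and char: "\<And>t. (CLINT \<omega>|M. of_real (W \<omega>) * iexp (\<Sum>i\<in>I. t i * X i \<omega>))
      = of_real (C * exp (- quad_form I R t / 2))"
  shows "(\<integral>\<^sup>+\<omega>. ennreal (W \<omega> * exp (\<Sum>i\<in>I. t i * X i \<omega>)) \<partial>M)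
      = ennreal (C * exp (quad_form I R t / 2))"
proof -
  let ?N = std_normal_distribution
  define \<nu> where "\<nu> = density M (\<lambda>\<omega>. ennreal (W \<omega> / C))"
  have W_int: "integrable M W"
    using W by (intro integrable_const_bound[where B = 1]) auto
  have "complex_of_real (expectation W) = of_real C"
    using char[of "\<lambda>_. 0"] by (simp add: quad_form_def)
  then have W_exp: "expectation W = C" by (simp only: of_real_eq_iff)
  have \<nu>_prob: "prob_space \<nu>"
  proof
    have "emeasure \<nu> (space \<nu>) = (\<integral>\<^sup>+\<omega>. ennreal (W \<omega> / C) \<partial>M)"
      unfolding \<nu>_def by (subst emeasure_density) (auto intro!: nn_integral_cong)
    also have "\<dots> = ennreal (expectation (\<lambda>\<omega>. W \<omega> / C))"
      using W_int W C by (intro nn_integral_eq_integral) auto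
    finally show "emeasure \<nu> (space \<nu>) = 1" using C W_exp by simp
  qed
  interpret \<nu>: prob_space \<nu> by (rule \<nu>_prob)
  define Y where "Y \<omega> = (\<Sum>i\<in>I. t i * X i \<omega>)" for \<omega>
  have Y_meas [measurable]: "Y \<in> borel_measurable M" unfolding Y_def by measurable
  have Y_meas' [measurable]: "Y \<in> borel_measurable \<nu>" by (simp add: \<nu>_def)
  define D where "D = distr \<nu> borel Y"
  have D_real: "real_distribution D"
    unfolding D_def by (rule \<nu>.real_distribution_distr) (simp)
  interpret D: real_distribution D by (rule D_real)
  have char_D: "char D s = of_real (exp (- (s\<^sup>2 * quad_form I R t) / 2))" for s
  proof -
    have "char D s = (CLINT \<omega>|\<nu>. iexp (s * Y \<omega>))"
      unfolding char_def D_def by (subst integral_distr) auto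
    also have "\<dots> = (CLINT \<omega>|M. (W \<omega> / C) *\<^sub>R iexp (s * Y \<omega>))"
      unfolding \<nu>_def using W C by (subst integral_density) auto
    also have "\<dots> = (CLINT \<omega>|M. of_real (1 / C) * (of_real (W \<omega>) * iexp (\<Sum>i\<in>I. (s * t i) * X i \<omega>)))"
      by (intro Bochner_Integration.integral_cong refl)
        (simp add: Y_def sum_distrib_left mult_ac scaleR_conv_of_real)
    also have "\<dots> = of_real (1 / C) * of_real (C * exp (- quad_form I R (\<lambda>i. s * t i) / 2))"
      unfolding char[symmetric] by (rule integral_mult_right_zero)
    also have "quad_form I R (\<lambda>i. s * t i) = s\<^sup>2 * quad_form I R t"
      by (simp add: quad_form_def sum_distrib_left power2_eq_square mult_ac)
    finally show ?thesis using C by simp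
  qed
  have nonneg: "0 \<le> quad_form I R t"
    using D.cmod_char_le_1[of 1] unfolding char_D by simp
  define \<sigma> where "\<sigma> = sqrt (quad_form I R t)"
  interpret N: prob_space ?N by (rule prob_space_std_normal)
  have "D = distr ?N borel (\<lambda>x. \<sigma> * x)"
  proof (rule Levy_uniqueness[OF D_real])
    show "real_distribution (distr ?N borel (\<lambda>x. \<sigma> * x))"
      by (rule N.real_distribution_distr) simp
    show "char D = char (distr ?N borel (\<lambda>x. \<sigma> * x))"
    proof
      fix s
      have "char (distr ?N borel (\<lambda>x. \<sigma> * x)) s = char ?N (s * \<sigma>)"
        unfolding char_def by (subst integral_distr) (auto simp: mult_ac)
      then show "char D s = char (distr ?N borel (\<lambda>x. \<sigma> * x)) s"
        unfolding char_D char_std_normal_distribution using nonneg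
        by (simp add: \<sigma>_def power_mult_distrib)
    qed
  qed
  then have "(\<integral>\<^sup>+y. ennreal (exp y) \<partial>D) = (\<integral>\<^sup>+x. ennreal (exp (\<sigma> * x + 0 * x\<^sup>2)) \<partial>?N)"
    by (simp add: nn_integral_distr)
  also have "\<dots> = ennreal (exp (quad_form I R t / 2))"
    using nonneg by (subst nn_integral_exp_quadratic_std_normal) (auto simp: \<sigma>_def)
  finally have "(\<integral>\<^sup>+\<omega>. ennreal (exp (Y \<omega>)) \<partial>\<nu>) = ennreal (exp (quad_form I R t / 2))"
    unfolding D_def by (simp add: nn_integral_distr)
  moreover have "(\<integral>\<^sup>+\<omega>. ennreal (exp (Y \<omega>)) \<partial>\<nu>) = (\<integral>\<^sup>+\<omega>. ennreal (W \<omega> / C) * ennreal (exp (Y \<omega>)) \<partial>M)"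
    unfolding \<nu>_def by (rule nn_integral_density) auto
  ultimately have *: "(\<integral>\<^sup>+\<omega>. ennreal (W \<omega> / C) * ennreal (exp (Y \<omega>)) \<partial>M)
      = ennreal (exp (quad_form I R t / 2))" by simp
  have "(\<integral>\<^sup>+\<omega>. ennreal (W \<omega> * exp (Y \<omega>)) \<partial>M)
      = (\<integral>\<^sup>+\<omega>. ennreal C * (ennreal (W \<omega> / C) * ennreal (exp (Y \<omega>))) \<partial>M)"
    using C W by (intro nn_integral_cong) (simp add: ennreal_mult[symmetric])
  also have "\<dots> = ennreal C * ennreal (exp (quad_form I R t / 2))"
    unfolding *[symmetric] by (rule nn_integral_cmult) measurable
  finally show ?thesis using C by (simp add: ennreal_mult[symmetric] Y_def)
qed

section \<open>The covariance matrix of a tilted law\<close>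

text \<open>
  The expansion of \<open>- log (1 - u) / 2\<close>, correct to second order. The coefficient of \<open>u\<^sup>2\<close> enters the
  variance of the weighted sum of squares, and so the constant of the main result.
\<close>

lemma inverse_sqrt_one_minus_le:
  fixes u :: real
  assumes u: "\<bar>u\<bar> \<le> 1 / 4"
  shows "1 / sqrt (1 - u) \<le> exp (u / 2 + u\<^sup>2 / 4 + \<bar>u\<bar> ^ 3 / 2)"
proof -
  have "- ln (1 - u) \<le> u + u\<^sup>2 / 2 + \<bar>u\<bar> ^ 3"
  proof (cases "u \<ge> 0")
    case True
    define g where "g x = x + x\<^sup>2 / 2 + x ^ 3 + ln (1 - x)" for x :: real
    have "g 0 \<le> g u"
    proof (rule DERIV_nonneg_imp_nondecreasing[OF True])
      fix x assume x: "0 \<le> x" "x \<le> u"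
      have x4: "x \<le> 1 / 4" using x u by simp
      have "(g has_real_derivative 1 + x + 3 * x\<^sup>2 - 1 / (1 - x)) (at x)"
        unfolding g_def using x4 by (auto intro!: derivative_eq_intros)
      moreover have "1 + x + 3 * x\<^sup>2 - 1 / (1 - x) = x\<^sup>2 * (2 - 3 * x) / (1 - x)"
        using x4 by (simp add: field_simps power2_eq_square)
      moreover have "\<dots> \<ge> 0" using x4 x by (intro divide_nonneg_nonneg mult_nonneg_nonneg) auto
      ultimately show "\<exists>y. (g has_real_derivative y) (at x) \<and> 0 \<le> y" by auto
    qed
    then show ?thesis using True by (simp add: g_def)
  next
    case False
    define g where "g x = - x + x\<^sup>2 / 2 + x ^ 3 + ln (1 + x)" for x :: real
    have "g 0 \<le> g (- u)"
    proof (rule DERIV_nonneg_imp_nondecreasing[where f = g and a = 0 and b = "- u"])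
      show "0 \<le> - u" using False by simp
      fix x assume x: "0 \<le> x" "x \<le> - u"
      have "(g has_real_derivative - 1 + x + 3 * x\<^sup>2 + 1 / (1 + x)) (at x)"
        unfolding g_def using x by (auto intro!: derivative_eq_intros)
      moreover have "- 1 + x + 3 * x\<^sup>2 + 1 / (1 + x) = x\<^sup>2 * (4 + 3 * x) / (1 + x)"
        using x by (simp add: field_simps power2_eq_square)
      moreover have "\<dots> \<ge> 0" using x by (intro divide_nonneg_nonneg mult_nonneg_nonneg) auto
      ultimately show "\<exists>y. (g has_real_derivative y) (at x) \<and> 0 \<le> y" by auto
    qed
    then show ?thesis using False by (simp add: g_def)
  qed
  then have le: "- ln (1 - u) / 2 \<le> u / 2 + u\<^sup>2 / 4 + \<bar>u\<bar> ^ 3 / 2" by simp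
  have "1 / sqrt (1 - u) = exp (- ln (1 - u) / 2)"
    using u by (simp add: exp_minus ln_sqrt[symmetric] inverse_eq_divide)
  also have "\<dots> \<le> exp (u / 2 + u\<^sup>2 / 4 + \<bar>u\<bar> ^ 3 / 2)" using le by (simp only: exp_le_cancel_iff)
  finally show ?thesis .
qed

text \<open>
  The tilt \<open>exp (\<Sum> d\<^sub>i X\<^sub>i\<^sup>2)\<close> of a Gaussian law with covariance \<open>R0\<close>. Both the tilt \<open>d\<close> and the
  matrix \<open>R0\<close> are measured in norms for which \<open>diag(d) R0\<close> has row sums at most \<open>\<theta> \<sigma>\<close>, so that the
  resolvent below is given by a rapidly convergent Neumann series. The value \<open>1/16\<close> keeps
  \<open>2 d\<^sub>k R\<^sub>k\<^sub>k\<close> within \<open>1/4\<close> for every covariance \<open>R\<close> on the way.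
\<close>

locale small_tilt =
  fixes I :: "'i set" and R0 :: "'i \<Rightarrow> 'i \<Rightarrow> real" and d :: "'i \<Rightarrow> real" and \<sigma> \<theta> :: real
  assumes finite_I: "finite I"
    and sym0: "\<And>i j. R0 i j = R0 j i"
    and row0: "\<And>i. i \<in> I \<Longrightarrow> (\<Sum>j\<in>I. \<bar>R0 i j\<bar>) \<le> \<sigma>"
    and tilt: "\<And>i. i \<in> I \<Longrightarrow> \<bar>d i\<bar> \<le> \<theta>"
    and \<sigma>: "0 \<le> \<sigma>" and \<theta>: "0 \<le> \<theta>"
    and small: "\<theta> * \<sigma> \<le> 1 / 16"
begin

text \<open>
  The resolvent identity \<open>R = R0 + 2 R0 D R\<close>, where \<open>D\<close> is the diagonal matrix of the tilts in \<open>J\<close>; it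
  characterises the covariance \<open>(R0\<^sup>-\<^sup>1 - 2 D)\<^sup>-\<^sup>1\<close> of the tilted law without inverting \<open>R0\<close>, which
  may be singular.
\<close>

definition tilted :: "'i set \<Rightarrow> ('i \<Rightarrow> 'i \<Rightarrow> real) \<Rightarrow> bool" where
  "tilted J R \<longleftrightarrow> (\<forall>i j. R i j = R j i) \<and>
     (\<forall>i j. R i j = R0 i j + 2 * (\<Sum>m\<in>J. d m * R0 i m * R m j))"

lemma tilted_empty: "tilted {} R0"
  using sym0 by (simp add: tilted_def)

lemma tilted_sym: "tilted J R \<Longrightarrow> R i j = R j i"
  unfolding tilted_def by blast

lemma tilted_eq: "tilted J R \<Longrightarrow> R i j = R0 i j + 2 * (\<Sum>m\<in>J. d m * R0 i m * R m j)"
  unfolding tilted_def by blast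

text \<open>
  This is the Sherman--Morrison formula. The row \<open>k\<close> of the new matrix \<open>R'\<close> is the row \<open>k\<close> of \<open>R\<close>
  divided by \<open>1 - 2 d\<^sub>k R\<^sub>k\<^sub>k\<close>, so that \<open>R' = R + 2 d\<^sub>k R e\<^sub>k e\<^sub>k\<^sup>T R'\<close>; inserting this in the right-hand
  side of the identity for \<open>R\<close> gives the one for \<open>R'\<close>.
\<close>

lemma tilted_insert:
  assumes R: "tilted J R" and J: "finite J" "k \<notin> J" and pole: "2 * d k * R k k \<noteq> 1"
  shows "tilted (insert k J) (rank_one_update (d k) k R)"
proof -
  define R' where "R' = rank_one_update (d k) k R"
  note sym = tilted_sym[OF R] and res = tilted_eq[OF R]
  have R'_k: "R' k j = R k j / (1 - 2 * d k * R k k)" for j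
    using pole by (simp add: R'_def rank_one_update_def field_simps)
  have R'_eq: "R' i j = R i j + 2 * d k * R i k * R' k j" for i j
    by (simp add: R'_k) (simp add: R'_def rank_one_update_def)
  have "R' i j = R0 i j + 2 * (\<Sum>m\<in>insert k J. d m * R0 i m * R' m j)" for i j
  proof -
    have "(\<Sum>m\<in>J. d m * R0 i m * R' m j)
        = (\<Sum>m\<in>J. d m * R0 i m * R m j) + 2 * d k * R' k j * (\<Sum>m\<in>J. d m * R0 i m * R m k)"
      by (subst R'_eq) (simp add: ring_distribs sum.distrib sum_distrib_left mult_ac)
    also have "\<dots> = (R i j - R0 i j) / 2 + d k * R' k j * (R i k - R0 i k)"
      using res[of i j] res[of i k] by (simp add: algebra_simps)
    finally have *: "(\<Sum>m\<in>J. d m * R0 i m * R' m j)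
        = (R i j - R0 i j) / 2 + d k * R' k j * (R i k - R0 i k)" .
    show ?thesis
      using J by (simp add: * R'_eq[of i j]) (simp add: algebra_simps diff_divide_distrib)
  qed
  moreover have "R' i j = R' j i" for i j
    using sym[of i j] sym[of i k] sym[of k j] by (simp add: R'_def rank_one_update_def mult_ac)
  ultimately show ?thesis
    unfolding tilted_def R'_def[symmetric] by blast
qed

lemma weighted_row_bound:
  assumes J: "J \<subseteq> I" and i: "i \<in> I" and g: "\<And>m. m \<in> J \<Longrightarrow> \<bar>g m\<bar> \<le> B" and B: "0 \<le> B"
  shows "\<bar>\<Sum>m\<in>J. d m * R0 i m * g m\<bar> \<le> \<theta> * \<sigma> * B"
proof -
  have "\<bar>\<Sum>m\<in>J. d m * R0 i m * g m\<bar> \<le> (\<Sum>m\<in>J. \<theta> * B * \<bar>R0 i m\<bar>)"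
  proof (rule order_trans[OF sum_abs sum_mono])
    fix m assume m: "m \<in> J"
    have "\<bar>d m\<bar> * \<bar>g m\<bar> \<le> \<theta> * B"
      using J m tilt[of m] g[OF m] \<theta> by (intro mult_mono) auto
    then have "(\<bar>d m\<bar> * \<bar>g m\<bar>) * \<bar>R0 i m\<bar> \<le> \<theta> * B * \<bar>R0 i m\<bar>"
      by (rule mult_right_mono) simp
    then show "\<bar>d m * R0 i m * g m\<bar> \<le> \<theta> * B * \<bar>R0 i m\<bar>"
      by (simp add: abs_mult mult_ac)
  qed
  also have "\<dots> \<le> \<theta> * B * (\<Sum>m\<in>I. \<bar>R0 i m\<bar>)"
    using J finite_I \<theta> B
    by (auto simp: sum_distrib_left[symmetric] intro!: mult_left_mono sum_mono2)
  also have "\<dots> \<le> \<theta> * B * \<sigma>"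
    using row0[OF i] \<theta> B by (intro mult_left_mono) auto
  finally show ?thesis by (simp add: mult_ac)
qed

text \<open>
  Apply the resolvent identity at the largest entry \<open>B\<close> of a column: \<open>B \<le> \<sigma> + 2 \<theta> \<sigma> B\<close>, and
  \<open>\<theta> \<sigma>\<close> is small.
\<close>

lemma tilted_entry_bound:
  assumes R: "tilted J R" and J: "J \<subseteq> I" and ij: "i \<in> I" "j \<in> I"
  shows "\<bar>R i j\<bar> \<le> 2 * \<sigma>"
proof -
  define B where "B = Max ((\<lambda>i. \<bar>R i j\<bar>) ` I)"
  have le_B: "\<bar>R m j\<bar> \<le> B" if "m \<in> I" for m
    unfolding B_def using finite_I that by (intro Max_ge) auto
  have B: "0 \<le> B" using le_B[OF ij(1)] by linarith
  have "B \<in> (\<lambda>i. \<bar>R i j\<bar>) ` I"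
    unfolding B_def using finite_I ij by (intro Max_in) auto
  then obtain l where l: "l \<in> I" "B = \<bar>R l j\<bar>" by auto
  have "\<bar>R0 l j\<bar> \<le> (\<Sum>j\<in>I. \<bar>R0 l j\<bar>)"
    using finite_I ij by (intro member_le_sum) auto
  with row0[OF l(1)] have R0: "\<bar>R0 l j\<bar> \<le> \<sigma>" by linarith
  have "\<bar>\<Sum>m\<in>J. d m * R0 l m * R m j\<bar> \<le> \<theta> * \<sigma> * B"
    using J le_B B by (intro weighted_row_bound l) auto
  then have "B \<le> \<sigma> + 2 * (\<theta> * \<sigma> * B)"
    using R0 tilted_eq[OF R, of l j] l(2) by linarith
  also have "\<theta> * \<sigma> * B \<le> 1 / 16 * B" using small B by (intro mult_right_mono)
  finally have "B \<le> 2 * \<sigma>" using \<sigma> by simp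
  with le_B[OF ij(1)] show ?thesis by linarith
qed

lemma tilted_entry_diff:
  assumes R: "tilted J R" and J: "J \<subseteq> I" and ij: "i \<in> I" "j \<in> I"
  shows "\<bar>R i j - R0 i j\<bar> \<le> 4 * \<theta> * \<sigma>\<^sup>2"
proof -
  have "\<bar>\<Sum>m\<in>J. d m * R0 i m * R m j\<bar> \<le> \<theta> * \<sigma> * (2 * \<sigma>)"
    using J ij \<sigma> tilted_entry_bound[OF R J] by (intro weighted_row_bound) auto
  then show ?thesis
    using tilted_eq[OF R, of i j] by (simp add: power2_eq_square)
qed

text \<open>
  The resolvent identity, used twice.
\<close>

lemma tilted_diagonal_second_order:
  assumes R: "tilted J R" and J: "J \<subseteq> I" and k: "k \<in> I"
  shows "\<bar>R k k - (R0 k k + 2 * (\<Sum>m\<in>J. d m * (R0 k m)\<^sup>2))\<bar> \<le> 8 * \<theta>\<^sup>2 * \<sigma> ^ 3"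
proof -
  have "R k k - (R0 k k + 2 * (\<Sum>m\<in>J. d m * (R0 k m)\<^sup>2)) = 2 * (\<Sum>m\<in>J. d m * R0 k m * (R m k - R0 m k))"
  proof -
    have "(\<Sum>m\<in>J. d m * R0 k m * (R m k - R0 m k))
        = (\<Sum>m\<in>J. d m * R0 k m * R m k) - (\<Sum>m\<in>J. d m * (R0 k m)\<^sup>2)"
      unfolding sum_subtractf[symmetric]
    proof (rule sum.cong[OF refl])
      fix m
      show "d m * R0 k m * (R m k - R0 m k) = d m * R0 k m * R m k - d m * (R0 k m)\<^sup>2"
        unfolding sym0[of m k] by (simp add: algebra_simps power2_eq_square)
    qed
    with tilted_eq[OF R, of k k] show ?thesis by linarith
  qed
  moreover have "\<bar>\<Sum>m\<in>J. d m * R0 k m * (R m k - R0 m k)\<bar> \<le> \<theta> * \<sigma> * (4 * \<theta> * \<sigma>\<^sup>2)"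
    using J k \<theta> tilted_entry_diff[OF R J] by (intro weighted_row_bound) auto
  ultimately show ?thesis by (simp add: power2_eq_square power3_eq_cube mult_ac)
qed

text \<open>
  The logarithm of \<open>E exp (\<Sum>\<^sub>J d\<^sub>i X\<^sub>i\<^sup>2)\<close> up to terms of third order: the mean and half the variance.
\<close>

definition second_order_log_mgf :: "'i set \<Rightarrow> real" where
  "second_order_log_mgf J = (\<Sum>i\<in>J. d i * R0 i i) + (\<Sum>i\<in>J. \<Sum>j\<in>J. d i * d j * (R0 i j)\<^sup>2)"

lemma second_order_log_mgf_insert:
  assumes "finite J" "k \<notin> J"
  shows "second_order_log_mgf (insert k J) = second_order_log_mgf J + d k * R0 k k + (d k * R0 k k)\<^sup>2
    + 2 * d k * (\<Sum>m\<in>J. d m * (R0 k m)\<^sup>2)"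
proof -
  have "(\<Sum>i\<in>J. d i * d k * (R0 i k)\<^sup>2) = d k * (\<Sum>m\<in>J. d m * (R0 k m)\<^sup>2)"
    unfolding sum_distrib_left by (intro sum.cong refl) (simp add: sym0[of k])
  moreover have "(\<Sum>j\<in>J. d k * d j * (R0 k j)\<^sup>2) = d k * (\<Sum>m\<in>J. d m * (R0 k m)\<^sup>2)"
    by (simp add: sum_distrib_left mult_ac)
  ultimately show ?thesis
    using assms by (simp add: second_order_log_mgf_def sum.distrib power_mult_distrib power2_eq_square)
qed

lemma tilted_pole_bound:
  assumes R: "tilted J R" and J: "J \<subseteq> I" and k: "k \<in> I"
  shows "\<bar>2 * d k * R k k\<bar> \<le> 4 * (\<theta> * \<sigma>)"
proof -
  have "\<bar>d k\<bar> * \<bar>R k k\<bar> \<le> \<theta> * (2 * \<sigma>)"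
    using tilt[OF k] tilted_entry_bound[OF R J k k] \<theta> by (intro mult_mono) auto
  then show ?thesis by (simp add: abs_mult mult_ac)
qed

text \<open>
  The mass factor contributed by the coordinate \<open>k\<close> matches the increment of the second-order
  expansion: the squares \<open>R0\<^sub>k\<^sub>m\<^sup>2\<close> with \<open>m \<in> J\<close> come from the first-order change of \<open>R\<^sub>k\<^sub>k\<close> under the
  earlier tilts, the square \<open>R0\<^sub>k\<^sub>k\<^sup>2\<close> from the second-order term of the logarithm. The three error
  terms \<open>8\<close>, \<open>12\<close> and \<open>32\<close> times \<open>(\<theta> \<sigma>)\<^sup>3\<close> add up to \<open>52\<close>.
\<close>

lemma tilted_factor_bound:
  assumes R: "tilted J R" and J: "J \<subseteq> I" and k: "k \<in> I" "k \<notin> J"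
  shows "1 / sqrt (1 - 2 * d k * R k k)
    \<le> exp (second_order_log_mgf (insert k J) - second_order_log_mgf J + 52 * (\<theta> * \<sigma>) ^ 3)"
proof -
  define q where "q = \<theta> * \<sigma>"
  define u where "u = 2 * d k * R k k"
  have q: "0 \<le> q" "q \<le> 1 / 16" using small \<theta> \<sigma> by (auto simp: q_def)
  have u: "\<bar>u\<bar> \<le> 4 * q" unfolding u_def q_def by (rule tilted_pole_bound[OF R J k(1)])
  have first: "u / 2 \<le> d k * R0 k k + 2 * d k * (\<Sum>m\<in>J. d m * (R0 k m)\<^sup>2) + 8 * q ^ 3"
  proof -
    let ?e = "R k k - (R0 k k + 2 * (\<Sum>m\<in>J. d m * (R0 k m)\<^sup>2))"
    have "\<bar>d k\<bar> * \<bar>?e\<bar> \<le> \<theta> * (8 * \<theta>\<^sup>2 * \<sigma> ^ 3)"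
      using tilt[OF k(1)] tilted_diagonal_second_order[OF R J k(1)] \<theta> by (intro mult_mono) auto
    then have "d k * ?e \<le> \<theta> * (8 * \<theta>\<^sup>2 * \<sigma> ^ 3)"
      by (simp add: abs_mult[symmetric])
    then show ?thesis
      by (simp add: u_def q_def algebra_simps power2_eq_square power3_eq_cube)
  qed
  have second: "u\<^sup>2 / 4 \<le> (d k * R0 k k)\<^sup>2 + 12 * q ^ 3"
  proof -
    have a: "\<bar>d k * R k k - d k * R0 k k\<bar> \<le> 4 * q\<^sup>2"
    proof -
      have "\<bar>d k\<bar> * \<bar>R k k - R0 k k\<bar> \<le> \<theta> * (4 * \<theta> * \<sigma>\<^sup>2)"
        using tilt[OF k(1)] tilted_entry_diff[OF R J k(1) k(1)] \<theta> by (intro mult_mono) auto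
      then show ?thesis by (simp add: abs_mult[symmetric] algebra_simps q_def power2_eq_square)
    qed
    have R0: "\<bar>R0 k k\<bar> \<le> \<sigma>"
      using member_le_sum[of k I "\<lambda>j. \<bar>R0 k j\<bar>"] row0[OF k(1)] k finite_I by simp
    have "\<bar>d k\<bar> * \<bar>R0 k k\<bar> \<le> \<theta> * \<sigma>"
      using tilt[OF k(1)] R0 \<theta> by (intro mult_mono) auto
    then have b: "\<bar>d k * R k k + d k * R0 k k\<bar> \<le> 3 * q"
      using u by (simp add: abs_mult[symmetric] q_def u_def)
    have "(d k * R k k)\<^sup>2 - (d k * R0 k k)\<^sup>2
        = (d k * R k k - d k * R0 k k) * (d k * R k k + d k * R0 k k)"
      by (simp add: power2_eq_square algebra_simps)
    also have "\<dots> \<le> \<bar>d k * R k k - d k * R0 k k\<bar> * \<bar>d k * R k k + d k * R0 k k\<bar>"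
      by (metis abs_ge_self abs_mult)
    also have "\<dots> \<le> (4 * q\<^sup>2) * (3 * q)"
      using a b by (intro mult_mono) auto
    finally show ?thesis
      by (simp add: u_def power2_eq_square power3_eq_cube)
  qed
  have third: "\<bar>u\<bar> ^ 3 / 2 \<le> 32 * q ^ 3"
    using power_mono[OF u, of 3] by (simp add: power_mult_distrib)
  have "1 / sqrt (1 - u) \<le> exp (u / 2 + u\<^sup>2 / 4 + \<bar>u\<bar> ^ 3 / 2)"
    using u q by (intro inverse_sqrt_one_minus_le) linarith
  also have "\<dots> \<le> exp (second_order_log_mgf (insert k J) - second_order_log_mgf J + 52 * q ^ 3)"
    using first second third second_order_log_mgf_insert[of J k] k J finite_I finite_subset[of J I]
    by (subst exp_le_cancel_iff) linarith
  finally show ?thesis by (simp add: u_def q_def)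
qed

text \<open>
  Each inner sum \<open>\<Sum>\<^sub>j d\<^sub>i d\<^sub>j R0\<^sub>i\<^sub>j\<^sup>2\<close> is at most \<open>\<theta>\<^sup>2 \<sigma> \<Sum>\<^sub>j \<bar>R0\<^sub>i\<^sub>j\<bar>\<close>, since a single entry is at most the row
  sum \<open>\<sigma>\<close>.
\<close>

lemma second_order_log_mgf_le:
  "second_order_log_mgf I \<le> (\<Sum>i\<in>I. d i * R0 i i) + real (card I) * (\<theta> * \<sigma>)\<^sup>2"
proof -
  have "(\<Sum>j\<in>I. d i * d j * (R0 i j)\<^sup>2) \<le> (\<theta> * \<sigma>)\<^sup>2" if i: "i \<in> I" for i
  proof -
    have le: "\<bar>R0 i j\<bar> \<le> \<sigma>" if "j \<in> I" for j
      using member_le_sum[of j I "\<lambda>j. \<bar>R0 i j\<bar>"] row0[OF i] that finite_I by simp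
    have "(\<Sum>j\<in>I. d i * d j * (R0 i j)\<^sup>2) = d i * (\<Sum>j\<in>I. d j * R0 i j * R0 i j)"
      by (simp add: sum_distrib_left power2_eq_square mult_ac)
    also have "\<dots> \<le> \<bar>d i\<bar> * \<bar>\<Sum>j\<in>I. d j * R0 i j * R0 i j\<bar>"
      by (metis abs_ge_self abs_mult)
    also have "\<dots> \<le> \<theta> * (\<theta> * \<sigma> * \<sigma>)"
      using tilt[OF i] \<theta> \<sigma> le i by (intro mult_mono weighted_row_bound) auto
    finally show ?thesis by (simp add: power2_eq_square mult_ac)
  qed
  then have "(\<Sum>i\<in>I. \<Sum>j\<in>I. d i * d j * (R0 i j)\<^sup>2) \<le> (\<Sum>i\<in>I. (\<theta> * \<sigma>)\<^sup>2)"
    by (rule sum_mono)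
  then show ?thesis by (simp add: second_order_log_mgf_def)
qed

end

section \<open>Tails of weighted sums of Gaussian squares\<close>

text \<open>
  The rank-one tilts are applied for one index after another: first, on characteristic functions,
  for the indices with \<open>d\<^sub>i \<le> 0\<close>, where the density stays bounded by \<open>1\<close>; then, on moment generating
  functions, for the others.
\<close>

lemma (in prob_space) nn_integral_exp_weighted_squares_le:
  fixes X :: "'i \<Rightarrow> 'a \<Rightarrow> real"
  assumes X [measurable]: "\<And>i. X i \<in> borel_measurable M"
    and "small_tilt I R0 d \<sigma> \<theta>"
    and char0: "\<And>t. (CLINT \<omega>|M. iexp (\<Sum>i\<in>I. t i * X i \<omega>)) = of_real (exp (- quad_form I R0 t / 2))"
  shows "(\<integral>\<^sup>+\<omega>. ennreal (exp (\<Sum>i\<in>I. d i * (X i \<omega>)\<^sup>2)) \<partial>M)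
    \<le> ennreal (exp ((\<Sum>i\<in>I. d i * R0 i i) + real (card I) * ((\<theta> * \<sigma>)\<^sup>2 + 52 * (\<theta> * \<sigma>) ^ 3)))"
proof -
  interpret small_tilt I R0 d \<sigma> \<theta> by fact
  define q where "q = \<theta> * \<sigma>"
  define W where "W J \<omega> = exp (\<Sum>i\<in>J. d i * (X i \<omega>)\<^sup>2)" for J \<omega>
  have W_meas [measurable]: "W J \<in> borel_measurable M" for J
    unfolding W_def by measurable
  have W_insert: "W (insert k J) \<omega> = W J \<omega> * exp (d k * (X k \<omega>)\<^sup>2)" if "finite J" "k \<notin> J" for k J \<omega>
    using that by (simp add: W_def exp_add mult.commute)
  \<comment> \<open>The invariant of both inductions: \<open>C\<close> is the total mass and \<open>R\<close> the covariance after tilting by the indices in \<open>J\<close>.\<close>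
  define good where "good J C R \<longleftrightarrow> 0 < C \<and> C \<le> exp (second_order_log_mgf J + real (card J) * (52 * q ^ 3)) \<and> tilted J R"
    for J C R
  have pole: "2 * d k * R k k < 1" if "tilted J R" "J \<subseteq> I" "k \<in> I" for J R k
    using tilted_pole_bound[OF that] small by linarith
  have good_insert: "good (insert k J) (C / sqrt (1 - 2 * d k * R k k)) (rank_one_update (d k) k R)"
    if "good J C R" "J \<subseteq> I" "k \<in> I" "k \<notin> J" for J C R k
  proof -
    have R: "tilted J R" using that by (simp add: good_def)
    have J: "finite J" using that finite_I finite_subset by blast
    note p = pole[OF R that(2,3)]
    have "C / sqrt (1 - 2 * d k * R k k) = C * (1 / sqrt (1 - 2 * d k * R k k))" by simp
    also have "\<dots> \<le> exp (second_order_log_mgf J + real (card J) * (52 * q ^ 3))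
        * exp (second_order_log_mgf (insert k J) - second_order_log_mgf J + 52 * q ^ 3)"
      using that tilted_factor_bound[OF R that(2-4)] p
      unfolding q_def[symmetric] good_def by (intro mult_mono) auto
    also have "\<dots> = exp (second_order_log_mgf (insert k J) + real (card (insert k J)) * (52 * q ^ 3))"
      using that J by (simp add: exp_add[symmetric] algebra_simps)
    finally show ?thesis
      using that p tilted_insert[OF R J that(4)] by (auto simp: good_def)
  qed
  \<comment> \<open>Index sets: \<open>neg\<close> runs through subsets of \<open>Neg\<close>, \<open>pos\<close> adds indices with positive tilt to all of \<open>Neg\<close>.\<close>
  define Neg where "Neg = {i \<in> I. d i \<le> 0}"
  have neg: "\<exists>C R. good J C R \<and> (\<forall>t. (CLINT \<omega>|M. of_real (W J \<omega>) * iexp (\<Sum>i\<in>I. t i * X i \<omega>))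
      = of_real (C * exp (- quad_form I R t / 2)))" if "finite J" "J \<subseteq> Neg" for J
    using that
  proof (induction J)
    case empty
    have "good {} 1 R0" by (simp add: good_def tilted_empty second_order_log_mgf_def)
    then show ?case
      using char0 by (intro exI[of _ 1] exI[of _ R0]) (simp add: W_def)
  next
    case (insert k J)
    then obtain C R where good: "good J C R"
      and IH: "\<And>t. (CLINT \<omega>|M. of_real (W J \<omega>) * iexp (\<Sum>i\<in>I. t i * X i \<omega>))
        = of_real (C * exp (- quad_form I R t / 2))" by auto
    have k: "k \<in> I" "d k \<le> 0" and J: "J \<subseteq> I" using insert by (auto simp: Neg_def)
    have R: "tilted J R" using good by (simp add: good_def)
    have W1: "W J \<omega> \<le> 1" for \<omega>
      unfolding W_def using insert by (auto simp: Neg_def intro!: sum_nonpos mult_nonpos_nonneg)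
    have "(CLINT \<omega>|M. of_real (W (insert k J) \<omega>) * iexp (\<Sum>i\<in>I. t i * X i \<omega>))
      = of_real (C / sqrt (1 - 2 * d k * R k k) * exp (- quad_form I (rank_one_update (d k) k R) t / 2))" for t
      unfolding W_insert[OF insert(1,2)]
      by (rule char_rank_one_tilt[OF X W_meas _ W1 finite_I k(1) tilted_sym[OF R] k(2) pole[OF R J k(1)] IH])
        (simp add: W_def)
    with good_insert[OF good J k(1) insert(2)] show ?case by blast
  qed
  have pos: "\<exists>C R. good (Neg \<union> J) C R \<and> (\<forall>t. (\<integral>\<^sup>+\<omega>. ennreal (W (Neg \<union> J) \<omega> * exp (\<Sum>i\<in>I. t i * X i \<omega>)) \<partial>M)
      = ennreal (C * exp (quad_form I R t / 2)))" if "finite J" "J \<subseteq> I - Neg" for J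
    using that
  proof (induction J)
    case empty
    have Neg: "finite Neg" using finite_I by (simp add: Neg_def)
    obtain C R where good: "good Neg C R"
      and char: "\<And>t. (CLINT \<omega>|M. of_real (W Neg \<omega>) * iexp (\<Sum>i\<in>I. t i * X i \<omega>))
        = of_real (C * exp (- quad_form I R t / 2))" using neg[OF Neg] by auto
    have W1: "W Neg \<omega> \<le> 1" for \<omega>
      unfolding W_def by (auto simp: Neg_def intro!: sum_nonpos mult_nonpos_nonneg)
    have "(\<integral>\<^sup>+\<omega>. ennreal (W Neg \<omega> * exp (\<Sum>i\<in>I. t i * X i \<omega>)) \<partial>M)
        = ennreal (C * exp (quad_form I R t / 2))" for t
      using good by (intro gaussian_char_imp_mgf char W1) (auto simp: W_def good_def)
    with good show ?case by auto
  next
    case (insert k J)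
    then obtain C R where good: "good (Neg \<union> J) C R"
      and IH: "\<And>t. (\<integral>\<^sup>+\<omega>. ennreal (W (Neg \<union> J) \<omega> * exp (\<Sum>i\<in>I. t i * X i \<omega>)) \<partial>M)
        = ennreal (C * exp (quad_form I R t / 2))" by auto
    have k: "k \<in> I" "0 \<le> d k" "k \<notin> Neg \<union> J" and J: "Neg \<union> J \<subseteq> I" "finite (Neg \<union> J)"
      using insert finite_I by (auto simp: Neg_def)
    have R: "tilted (Neg \<union> J) R" and C: "0 \<le> C" using good by (auto simp: good_def)
    have "(\<integral>\<^sup>+\<omega>. ennreal (W (insert k (Neg \<union> J)) \<omega> * exp (\<Sum>i\<in>I. t i * X i \<omega>)) \<partial>M)
      = ennreal (C / sqrt (1 - 2 * d k * R k k) * exp (quad_form I (rank_one_update (d k) k R) t / 2))" for t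
      unfolding W_insert[OF J(2) k(3)]
      by (rule mgf_rank_one_tilt[OF X W_meas _ C finite_I k(1) tilted_sym[OF R] k(2) pole[OF R J(1) k(1)] IH])
        (simp add: W_def)
    with good_insert[OF good J(1) k(1,3)] show ?case unfolding Un_insert_right by blast
  qed
  have "Neg \<union> (I - Neg) = I" by (auto simp: Neg_def)
  with pos[of "I - Neg"] finite_I obtain C R where good: "good I C R"
    and mgf: "\<And>t. (\<integral>\<^sup>+\<omega>. ennreal (W I \<omega> * exp (\<Sum>i\<in>I. t i * X i \<omega>)) \<partial>M)
      = ennreal (C * exp (quad_form I R t / 2))" by auto
  have "(\<integral>\<^sup>+\<omega>. ennreal (exp (\<Sum>i\<in>I. d i * (X i \<omega>)\<^sup>2)) \<partial>M) = ennreal C"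
    using mgf[of "\<lambda>_. 0"] by (simp add: W_def quad_form_def)
  also have "\<dots> \<le> ennreal (exp ((\<Sum>i\<in>I. d i * R0 i i) + real (card I) * (q\<^sup>2 + 52 * q ^ 3)))"
  proof (rule ennreal_leI)
    have "C \<le> exp (second_order_log_mgf I + real (card I) * (52 * q ^ 3))" using good by (simp add: good_def)
    also have "\<dots> \<le> exp ((\<Sum>i\<in>I. d i * R0 i i) + real (card I) * (q\<^sup>2 + 52 * q ^ 3))"
      using second_order_log_mgf_le by (simp add: q_def algebra_simps)
    finally show "C \<le> exp ((\<Sum>i\<in>I. d i * R0 i i) + real (card I) * (q\<^sup>2 + 52 * q ^ 3))" .
  qed
  finally show ?thesis by (simp add: q_def)
qed

text \<open>
  Chernoff's inequality, with the parameter \<open>\<theta>\<close> left open.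
\<close>

lemma (in prob_space) gaussian_squares_tail:
  fixes X :: "'i \<Rightarrow> 'a \<Rightarrow> real"
  assumes X [measurable]: "\<And>i. X i \<in> borel_measurable M"
    and I: "finite I" and sym: "\<And>i j. R0 i j = R0 j i"
    and row: "\<And>i. i \<in> I \<Longrightarrow> (\<Sum>j\<in>I. \<bar>R0 i j\<bar>) \<le> \<sigma>"
    and a: "\<And>i. i \<in> I \<Longrightarrow> \<bar>a i\<bar> \<le> 1"
    and \<sigma>: "0 \<le> \<sigma>" and \<theta>: "0 \<le> \<theta>" "\<theta> * \<sigma> \<le> 1 / 16"
    and char0: "\<And>t. (CLINT \<omega>|M. iexp (\<Sum>i\<in>I. t i * X i \<omega>)) = of_real (exp (- quad_form I R0 t / 2))"
  shows "prob {\<omega> \<in> space M. x \<le> (\<Sum>i\<in>I. a i * ((X i \<omega>)\<^sup>2 - R0 i i))}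
    \<le> exp (- \<theta> * x + real (card I) * ((\<theta> * \<sigma>)\<^sup>2 + 52 * (\<theta> * \<sigma>) ^ 3))"
proof -
  define A where "A = {\<omega> \<in> space M. x \<le> (\<Sum>i\<in>I. a i * ((X i \<omega>)\<^sup>2 - R0 i i))}"
  have [measurable]: "A \<in> sets M" unfolding A_def by measurable
  define m where "m = (\<Sum>i\<in>I. \<theta> * a i * R0 i i)"
  have "small_tilt I R0 (\<lambda>i. \<theta> * a i) \<sigma> \<theta>"
    using assms by unfold_locales (auto simp: abs_mult intro!: mult_left_le)
  then have mgf: "(\<integral>\<^sup>+\<omega>. ennreal (exp (\<Sum>i\<in>I. \<theta> * a i * (X i \<omega>)\<^sup>2)) \<partial>M)
      \<le> ennreal (exp (m + real (card I) * ((\<theta> * \<sigma>)\<^sup>2 + 52 * (\<theta> * \<sigma>) ^ 3)))"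
    unfolding m_def by (intro nn_integral_exp_weighted_squares_le X char0)
  have "emeasure M A = (\<integral>\<^sup>+\<omega>. indicator A \<omega> \<partial>M)" by simp
  also have "\<dots> \<le> (\<integral>\<^sup>+\<omega>. ennreal (exp (- \<theta> * x - m)) * ennreal (exp (\<Sum>i\<in>I. \<theta> * a i * (X i \<omega>)\<^sup>2)) \<partial>M)"
  proof (rule nn_integral_mono)
    fix \<omega>
    show "indicator A \<omega> \<le> ennreal (exp (- \<theta> * x - m)) * ennreal (exp (\<Sum>i\<in>I. \<theta> * a i * (X i \<omega>)\<^sup>2))"
    proof (cases "\<omega> \<in> A")
      case True
      then have "\<theta> * x \<le> \<theta> * (\<Sum>i\<in>I. a i * ((X i \<omega>)\<^sup>2 - R0 i i))"
        using \<theta> by (intro mult_left_mono) (auto simp: A_def)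
      also have "\<dots> = (\<Sum>i\<in>I. \<theta> * a i * (X i \<omega>)\<^sup>2) - m"
        by (simp add: m_def sum_distrib_left sum_subtractf algebra_simps)
      finally have "0 \<le> (- \<theta> * x - m) + (\<Sum>i\<in>I. \<theta> * a i * (X i \<omega>)\<^sup>2)" by simp
      then have "1 \<le> exp ((- \<theta> * x - m) + (\<Sum>i\<in>I. \<theta> * a i * (X i \<omega>)\<^sup>2))" by simp
      then show ?thesis using True by (simp only: exp_add) (simp add: ennreal_mult[symmetric])
    qed simp
  qed
  also have "\<dots> = ennreal (exp (- \<theta> * x - m)) * (\<integral>\<^sup>+\<omega>. ennreal (exp (\<Sum>i\<in>I. \<theta> * a i * (X i \<omega>)\<^sup>2)) \<partial>M)"
    by (rule nn_integral_cmult) measurable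
  also have "\<dots> \<le> ennreal (exp (- \<theta> * x - m))
      * ennreal (exp (m + real (card I) * ((\<theta> * \<sigma>)\<^sup>2 + 52 * (\<theta> * \<sigma>) ^ 3)))"
    by (intro mult_left_mono mgf) simp
  also have "\<dots> = ennreal (exp (- \<theta> * x + real (card I) * ((\<theta> * \<sigma>)\<^sup>2 + 52 * (\<theta> * \<sigma>) ^ 3)))"
    by (simp add: ennreal_mult[symmetric] exp_add[symmetric])
  finally show ?thesis
    unfolding A_def[symmetric] by (simp add: emeasure_eq_measure)
qed

section \<open>The covariance of a harmonizable process\<close>

definition square_integrable :: "'w measure \<Rightarrow> ('w \<Rightarrow> complex) \<Rightarrow> bool" where
  "square_integrable M g \<longleftrightarrow> g \<in> borel_measurable M \<and> integrable M (\<lambda>\<omega>. (cmod (g \<omega>))\<^sup>2)"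

lemma square_integrable_mult_cnj:
  assumes g: "square_integrable M g" and h: "square_integrable M h"
  shows "integrable M (\<lambda>\<omega>. g \<omega> * cnj (h \<omega>))"
proof (rule Bochner_Integration.integrable_bound)
  have [measurable]: "g \<in> borel_measurable M" "h \<in> borel_measurable M"
    using g h by (auto simp: square_integrable_def)
  show "integrable M (\<lambda>\<omega>. (cmod (g \<omega>))\<^sup>2 + (cmod (h \<omega>))\<^sup>2)"
    using g h by (auto simp: square_integrable_def)
  show "(\<lambda>\<omega>. g \<omega> * cnj (h \<omega>)) \<in> borel_measurable M"
    using borel_measurable_continuous_onI[OF continuous_on_cnj[OF continuous_on_id]] by measurable
  show "AE \<omega> in M. norm (g \<omega> * cnj (h \<omega>)) \<le> norm ((cmod (g \<omega>))\<^sup>2 + (cmod (h \<omega>))\<^sup>2)"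
  proof (rule AE_I2)
    fix \<omega>
    have "cmod (g \<omega>) * cmod (h \<omega>) \<le> (cmod (g \<omega>))\<^sup>2 + (cmod (h \<omega>))\<^sup>2"
      using sum_squares_bound[of "cmod (g \<omega>)" "cmod (h \<omega>)"]
        mult_nonneg_nonneg[OF norm_ge_zero[of "g \<omega>"] norm_ge_zero[of "h \<omega>"]] by linarith
    then show "norm (g \<omega> * cnj (h \<omega>)) \<le> norm ((cmod (g \<omega>))\<^sup>2 + (cmod (h \<omega>))\<^sup>2)"
      by (simp add: norm_mult)
  qed
qed

lemma square_integrable_scale:
  "square_integrable M g \<Longrightarrow> square_integrable M (\<lambda>\<omega>. c * g \<omega>)"
  by (auto simp: square_integrable_def norm_mult power_mult_distrib)

lemma square_integrable_add:
  assumes g: "square_integrable M g" and h: "square_integrable M h"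
  shows "square_integrable M (\<lambda>\<omega>. g \<omega> + h \<omega>)"
proof -
  have [measurable]: "g \<in> borel_measurable M" "h \<in> borel_measurable M"
    using g h by (auto simp: square_integrable_def)
  have "integrable M (\<lambda>\<omega>. (cmod (g \<omega> + h \<omega>))\<^sup>2)"
  proof (rule Bochner_Integration.integrable_bound)
    show "integrable M (\<lambda>\<omega>. 2 * (cmod (g \<omega>))\<^sup>2 + 2 * (cmod (h \<omega>))\<^sup>2)"
      using g h by (auto simp: square_integrable_def)
    show "AE \<omega> in M. norm ((cmod (g \<omega> + h \<omega>))\<^sup>2) \<le> norm (2 * (cmod (g \<omega>))\<^sup>2 + 2 * (cmod (h \<omega>))\<^sup>2)"
    proof (rule AE_I2)
      fix \<omega>
      have "(cmod (g \<omega> + h \<omega>))\<^sup>2 \<le> (cmod (g \<omega>) + cmod (h \<omega>))\<^sup>2"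
        by (intro power_mono norm_triangle_ineq) simp
      also have "\<dots> \<le> 2 * (cmod (g \<omega>))\<^sup>2 + 2 * (cmod (h \<omega>))\<^sup>2"
        using sum_squares_bound[of "cmod (g \<omega>)" "cmod (h \<omega>)"] by (simp add: power2_sum)
      finally show "norm ((cmod (g \<omega> + h \<omega>))\<^sup>2) \<le> norm (2 * (cmod (g \<omega>))\<^sup>2 + 2 * (cmod (h \<omega>))\<^sup>2)"
        by simp
    qed
  qed measurable
  then show ?thesis by (simp add: square_integrable_def)
qed

lemma square_integrable_diff:
  "square_integrable M g \<Longrightarrow> square_integrable M h \<Longrightarrow> square_integrable M (\<lambda>\<omega>. g \<omega> - h \<omega>)"
  using square_integrable_add[of M g "\<lambda>\<omega>. - 1 * h \<omega>"] square_integrable_scale[of M h "- 1"] by simp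

lemma square_integrable_sum:
  "(\<And>i. i \<in> I \<Longrightarrow> square_integrable M (g i)) \<Longrightarrow> square_integrable M (\<lambda>\<omega>. \<Sum>i\<in>I. g i \<omega>)"
  by (induction I rule: infinite_finite_induct)
    (auto simp: square_integrable_add, auto simp: square_integrable_def)

text \<open>
  A weighted form of \<open>2 p q \<le> p\<^sup>2 + q\<^sup>2\<close>, with a weight \<open>\<delta>\<close> depending on the target accuracy, replaces
  the Cauchy--Schwarz inequality.
\<close>

lemma mean_square_inner_tendsto_0:
  assumes P: "\<And>n. square_integrable M (P n)" and Q: "\<And>n. square_integrable M (Q n)"
    and P0: "(\<lambda>n. \<integral>\<omega>. (cmod (P n \<omega>))\<^sup>2 \<partial>M) \<longlonglongrightarrow> 0"
    and QK: "\<forall>\<^sub>F n in sequentially. (\<integral>\<omega>. (cmod (Q n \<omega>))\<^sup>2 \<partial>M) \<le> K"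
  shows "(\<lambda>n. \<integral>\<omega>. P n \<omega> * cnj (Q n \<omega>) \<partial>M) \<longlonglongrightarrow> 0"
proof (rule tendstoI)
  fix e :: real assume e: "0 < e"
  define \<delta> where "\<delta> = e / (\<bar>K\<bar> + 1)"
  have \<delta>: "0 < \<delta>" using e by (simp add: \<delta>_def)
  have "\<forall>\<^sub>F n in sequentially. (\<integral>\<omega>. (cmod (P n \<omega>))\<^sup>2 \<partial>M) < \<delta> * e"
    using \<delta> e by (intro order_tendstoD(2)[OF P0]) simp
  with QK show "\<forall>\<^sub>F n in sequentially. dist (\<integral>\<omega>. P n \<omega> * cnj (Q n \<omega>) \<partial>M) 0 < e"
  proof eventually_elim
    case (elim n)
    have int: "integrable M (\<lambda>\<omega>. (cmod (P n \<omega>))\<^sup>2)" "integrable M (\<lambda>\<omega>. (cmod (Q n \<omega>))\<^sup>2)"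
      using P Q by (auto simp: square_integrable_def)
    have "cmod (\<integral>\<omega>. P n \<omega> * cnj (Q n \<omega>) \<partial>M)
        \<le> (\<integral>\<omega>. (cmod (P n \<omega>))\<^sup>2 / (2 * \<delta>) + \<delta> / 2 * (cmod (Q n \<omega>))\<^sup>2 \<partial>M)"
    proof (rule order_trans[OF integral_norm_bound integral_mono])
      show "integrable M (\<lambda>\<omega>. cmod (P n \<omega> * cnj (Q n \<omega>)))"
        by (intro integrable_norm square_integrable_mult_cnj P Q)
      show "integrable M (\<lambda>\<omega>. (cmod (P n \<omega>))\<^sup>2 / (2 * \<delta>) + \<delta> / 2 * (cmod (Q n \<omega>))\<^sup>2)"
        using int by auto
      fix \<omega>
      \<comment> \<open>The weighted inequality \<open>p q \<le> p\<^sup>2 / (2 \<delta>) + \<delta> q\<^sup>2 / 2\<close>.\<close>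
      have "0 \<le> (cmod (P n \<omega>) - \<delta> * cmod (Q n \<omega>))\<^sup>2 / (2 * \<delta>)" using \<delta> by simp
      also have "\<dots> = (cmod (P n \<omega>))\<^sup>2 / (2 * \<delta>) + \<delta> / 2 * (cmod (Q n \<omega>))\<^sup>2 - cmod (P n \<omega>) * cmod (Q n \<omega>)"
        using \<delta> by (simp add: field_simps power2_eq_square)
      finally show "cmod (P n \<omega> * cnj (Q n \<omega>)) \<le> (cmod (P n \<omega>))\<^sup>2 / (2 * \<delta>) + \<delta> / 2 * (cmod (Q n \<omega>))\<^sup>2"
        by (simp add: norm_mult)
    qed
    also have "\<dots> = (\<integral>\<omega>. (cmod (P n \<omega>))\<^sup>2 \<partial>M) / (2 * \<delta>) + \<delta> / 2 * (\<integral>\<omega>. (cmod (Q n \<omega>))\<^sup>2 \<partial>M)"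
      using int by simp
    also have "\<dots> < (\<delta> * e) / (2 * \<delta>) + \<delta> / 2 * (\<bar>K\<bar> + 1)"
      using elim \<delta> by (intro add_less_le_mono divide_strict_right_mono mult_left_mono) auto
    also have "\<dots> = e"
    proof -
      have "\<delta> * (\<bar>K\<bar> + 1) = e" by (simp add: \<delta>_def)
      then show ?thesis using \<delta> by simp
    qed
    finally show ?case by simp
  qed
qed

lemma mean_square_inner_tendsto:
  assumes P: "\<And>n. square_integrable M (P n)" and Q: "\<And>n. square_integrable M (Q n)"
    and Y: "square_integrable M Y" and Y': "square_integrable M Y'"
    and PY: "(\<lambda>n. \<integral>\<omega>. (cmod (Y \<omega> - P n \<omega>))\<^sup>2 \<partial>M) \<longlonglongrightarrow> 0"
    and QY: "(\<lambda>n. \<integral>\<omega>. (cmod (Y' \<omega> - Q n \<omega>))\<^sup>2 \<partial>M) \<longlonglongrightarrow> 0"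
  shows "(\<lambda>n. \<integral>\<omega>. P n \<omega> * cnj (Q n \<omega>) \<partial>M) \<longlonglongrightarrow> (\<integral>\<omega>. Y \<omega> * cnj (Y' \<omega>) \<partial>M)"
proof -
  note DP = square_integrable_diff[OF Y P] and DQ = square_integrable_diff[OF Y' Q]
  let ?I = "\<lambda>g h. \<integral>\<omega>. g \<omega> * cnj (h \<omega>) \<partial>M"
  have a: "(\<lambda>n. ?I (\<lambda>\<omega>. Y \<omega> - P n \<omega>) Y') \<longlonglongrightarrow> 0"
    by (rule mean_square_inner_tendsto_0[OF DP Y' PY always_eventually]) blast
  have b: "(\<lambda>n. cnj (?I (\<lambda>\<omega>. Y' \<omega> - Q n \<omega>) Y)) \<longlonglongrightarrow> cnj 0"
    by (intro tendsto_cnj mean_square_inner_tendsto_0[OF DQ Y QY always_eventually]) blast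
  \<comment> \<open>The second factor only needs to be bounded; it tends to \<open>0\<close> in mean square, hence is eventually at most \<open>1\<close>.\<close>
  have c: "(\<lambda>n. ?I (\<lambda>\<omega>. Y \<omega> - P n \<omega>) (\<lambda>\<omega>. Y' \<omega> - Q n \<omega>)) \<longlonglongrightarrow> 0"
    by (rule mean_square_inner_tendsto_0[OF DP DQ PY, where K = 1])
      (use order_tendstoD(2)[OF QY, of 1] in \<open>auto elim: eventually_mono\<close>)
  \<comment> \<open>Expand \<open>P = Y - (Y - P)\<close> and \<open>Q = Y' - (Y' - Q)\<close>.\<close>
  have eq: "?I (P n) (Q n) = ?I Y Y' - ?I (\<lambda>\<omega>. Y \<omega> - P n \<omega>) Y'
      - cnj (?I (\<lambda>\<omega>. Y' \<omega> - Q n \<omega>) Y) + ?I (\<lambda>\<omega>. Y \<omega> - P n \<omega>) (\<lambda>\<omega>. Y' \<omega> - Q n \<omega>)" for n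
  proof -
    note [simp] = square_integrable_mult_cnj[OF Y Y'] square_integrable_mult_cnj[OF P Y']
      square_integrable_mult_cnj[OF Y Q] square_integrable_mult_cnj[OF P Q]
      square_integrable_mult_cnj[OF Y' Y] square_integrable_mult_cnj[OF Q Y]
    have "cnj (?I (\<lambda>\<omega>. Y' \<omega> - Q n \<omega>) Y) = (\<integral>\<omega>. cnj ((Y' \<omega> - Q n \<omega>) * cnj (Y \<omega>)) \<partial>M)"
      by (rule Bochner_Integration.integral_cnj[symmetric])
    also have "\<dots> = ?I Y Y' - ?I Y (Q n)"
      by (simp add: algebra_simps)
    finally have "cnj (?I (\<lambda>\<omega>. Y' \<omega> - Q n \<omega>) Y) = ?I Y Y' - ?I Y (Q n)" .
    moreover have "?I (\<lambda>\<omega>. Y \<omega> - P n \<omega>) Y' = ?I Y Y' - ?I (P n) Y'"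
      by (simp add: left_diff_distrib)
    moreover have "?I (\<lambda>\<omega>. Y \<omega> - P n \<omega>) (\<lambda>\<omega>. Y' \<omega> - Q n \<omega>)
        = (?I Y Y' - ?I (P n) Y') - (?I Y (Q n) - ?I (P n) (Q n))"
      by (simp add: left_diff_distrib right_diff_distrib)
    ultimately show ?thesis by simp
  qed
  have "(\<lambda>n. ?I Y Y' - ?I (\<lambda>\<omega>. Y \<omega> - P n \<omega>) Y'
      - cnj (?I (\<lambda>\<omega>. Y' \<omega> - Q n \<omega>) Y) + ?I (\<lambda>\<omega>. Y \<omega> - P n \<omega>) (\<lambda>\<omega>. Y' \<omega> - Q n \<omega>))
    \<longlonglongrightarrow> ?I Y Y' - 0 - cnj 0 + 0"
    by (intro tendsto_intros a b c)
  then show ?thesis unfolding eq by simp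
qed

text \<open>
  Wrapping changes the argument by a multiple of \<open>2\<pi>\<close>, and hence does not affect \<open>e\<^bsup>ikx\<^esup>\<close> for integers
  \<open>k\<close> (\<open>exp_wrap\<close>).
\<close>

lemma wrap_eq: "wrap x = x + 2 * pi * of_int \<lfloor>(pi - x) / (2 * pi)\<rfloor>"
proof -
  have "wrap x = pi - ((pi - x) / (2 * pi) - of_int \<lfloor>(pi - x) / (2 * pi)\<rfloor>) * (2 * pi)"
    by (simp add: wrap_def rmod_conv_frac frac_def)
  also have "\<dots> = pi - (pi - x) / (2 * pi) * (2 * pi) + 2 * pi * of_int \<lfloor>(pi - x) / (2 * pi)\<rfloor>"
    by (simp only: left_diff_distrib) simp
  finally show ?thesis by simp
qed

lemma wrap_in_freq: "wrap x \<in> freq"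
  using rmod_nonneg[of "2 * pi" "pi - x"] rmod_less[of "2 * pi" "pi - x"] by (simp add: wrap_def)

lemma borel_measurable_wrap [measurable]: "wrap \<in> borel_measurable borel"
  unfolding wrap_eq by measurable

lemma exp_wrap: "exp (\<i> * of_int k * of_real (wrap x)) = exp (\<i> * of_int k * of_real x)"
proof -
  have "\<i> * of_int k * of_real (wrap x)
      = \<i> * of_int k * of_real x + 2 * of_real pi * \<i> * of_int (k * \<lfloor>(pi - x) / (2 * pi)\<rfloor>)"
    by (simp add: wrap_eq algebra_simps)
  then show ?thesis using exp_integer_2pi[of "of_int (k * \<lfloor>(pi - x) / (2 * pi)\<rfloor>)"]
    by (simp add: exp_add mult_ac)
qed

definition level_set :: "(real \<Rightarrow> complex) \<Rightarrow> complex \<Rightarrow> real set" where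
  "level_set s v = {x \<in> freq. s x = v}"

lemma level_set_borel: "simple_function borel s \<Longrightarrow> level_set s v \<in> borel_subsets freq"
proof -
  assume s: "simple_function borel s"
  have "s -` {v} \<inter> space borel \<in> sets borel" using s by (rule simple_functionD)
  then have "freq \<inter> s -` {v} \<in> sets borel" by auto
  moreover have "level_set s v = freq \<inter> s -` {v}" by (auto simp: level_set_def)
  ultimately show ?thesis by (auto simp: borel_subsets_def)
qed

lemma sum_level_sets:
  assumes "simple_function borel s" "x \<in> freq"
  shows "(\<Sum>v\<in>s ` freq. v * indicator (level_set s v) x) = s x"
proof -
  have fin: "finite (s ` freq)"
    using simple_functionD(1)[OF assms(1)] by (rule finite_subset[rotated]) auto
  have "(\<Sum>v\<in>s ` freq. v * indicator (level_set s v) x) = (\<Sum>v\<in>s ` freq. if v = s x then v else 0)"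
    using assms by (intro sum.cong) (auto simp: level_set_def indicator_def)
  then show ?thesis using fin assms by simp
qed

text \<open>
  For simple integrands the inner product is a finite combination of values \<open>F (A \<times> B)\<close>. On each
  line, the indicators of the level sets recombine to the integrands themselves, because
  \<open>wrap (\<mu> + b)\<close> always lies in the domain \<open>freq\<close>.
\<close>

lemma simple_stochastic_integral_inner:
  assumes Z: "random_measure M Z F" and F: "has_line_densities F f" and fin: "finite (spectral_lines f)"
    and s: "simple_function borel s" and s': "simple_function borel s'"
  shows "square_integrable M (simple_stochastic_integral Z s)"
    and "(\<integral>\<omega>. simple_stochastic_integral Z s \<omega> * cnj (simple_stochastic_integral Z s' \<omega>) \<partial>M)
      = (\<Sum>b\<in>spectral_lines f. LINT \<mu>:freq|lborel. s (wrap (\<mu> + b)) * cnj (s' \<mu>) * f b \<mu>)"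
proof -
  let ?L = "spectral_lines f"
  have fins: "finite (s ` freq)" if "simple_function borel s" for s :: "real \<Rightarrow> complex"
    using simple_functionD(1)[OF that] by (rule finite_subset[rotated]) auto
  have Zsq: "square_integrable M (Z (level_set s v))" if "simple_function borel s" for s v
    using Z level_set_borel[OF that] by (simp add: random_measure_def square_integrable_def)
  have SI: "simple_stochastic_integral Z s = (\<lambda>\<omega>. \<Sum>v\<in>s ` freq. v * Z (level_set s v) \<omega>)" for s
    by (simp add: fun_eq_iff simple_stochastic_integral_def level_set_def)
  show "square_integrable M (simple_stochastic_integral Z s)"
    unfolding SI by (intro square_integrable_sum square_integrable_scale Zsq s)
  have Fint: "F (level_set s v \<times> level_set s' v')
      = (\<Sum>b\<in>?L. LINT \<mu>:freq|lborel. indicator (level_set s v) (wrap (\<mu> + b))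
          * indicator (level_set s' v') \<mu> * f b \<mu>)" for v v'
  proof -
    have S: "level_set s v \<times> level_set s' v' \<in> borel_subsets (freq \<times> freq)"
      using level_set_borel[OF s, of v] level_set_borel[OF s', of v']
      by (auto simp: borel_subsets_def borel_prod[symmetric])
    have "((\<lambda>b. LINT \<mu>:freq|lborel. indicator (level_set s v \<times> level_set s' v') (wrap (\<mu> + b), \<mu>) * f b \<mu>)
        has_sum F (level_set s v \<times> level_set s' v')) ?L"
      using F S by (simp add: has_line_densities_def)
    then have "F (level_set s v \<times> level_set s' v')
        = (\<Sum>b\<in>?L. LINT \<mu>:freq|lborel. indicator (level_set s v \<times> level_set s' v') (wrap (\<mu> + b), \<mu>) * f b \<mu>)"
      using fin has_sum_finite has_sum_unique by blast
    then show ?thesis by (simp add: indicator_times)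
  qed
  have int: "set_integrable lborel freq (\<lambda>\<mu>. indicator A (wrap (\<mu> + b)) * indicator B \<mu> * f b \<mu>)"
    if b: "b \<in> ?L" and A: "A \<in> borel_subsets freq" and B: "B \<in> borel_subsets freq" for b A B
  proof -
    have [measurable]: "A \<in> sets borel" "B \<in> sets borel" using A B by (auto simp: borel_subsets_def)
    have f: "set_integrable lborel freq (f b)" using F b by (simp add: has_line_densities_def)
    then have [measurable]: "(\<lambda>\<mu>. indicator freq \<mu> *\<^sub>R f b \<mu>) \<in> borel_measurable lborel"
      unfolding set_integrable_def by (rule borel_measurable_integrable)
    show ?thesis
      unfolding set_integrable_def
    proof (rule Bochner_Integration.integrable_bound[OF f[unfolded set_integrable_def]])
      have "(\<lambda>\<mu>. (indicator A (wrap (\<mu> + b)) * indicator B \<mu>) * (indicator freq \<mu> *\<^sub>R f b \<mu>))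
          \<in> borel_measurable lborel" by measurable
      then show "(\<lambda>\<mu>. indicator freq \<mu> *\<^sub>R (indicator A (wrap (\<mu> + b)) * indicator B \<mu> * f b \<mu>))
          \<in> borel_measurable lborel" by (simp add: mult_ac scaleR_conv_of_real)
      show "AE \<mu> in lborel. norm (indicator freq \<mu> *\<^sub>R (indicator A (wrap (\<mu> + b)) * indicator B \<mu> * f b \<mu>))
          \<le> norm (indicator freq \<mu> *\<^sub>R f b \<mu>)"
        by (auto simp: indicator_def)
    qed
  qed
  let ?A = "\<lambda>v. level_set s v" and ?B = "\<lambda>v. level_set s' v"
  have "(\<integral>\<omega>. simple_stochastic_integral Z s \<omega> * cnj (simple_stochastic_integral Z s' \<omega>) \<partial>M)
      = (\<integral>\<omega>. (\<Sum>v\<in>s ` freq. \<Sum>v'\<in>s' ` freq. v * cnj v' * (Z (?A v) \<omega> * cnj (Z (?B v') \<omega>))) \<partial>M)"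
    unfolding SI by (simp add: sum_product mult_ac)
  also have "\<dots> = (\<Sum>v\<in>s ` freq. \<Sum>v'\<in>s' ` freq. v * cnj v' * (\<integral>\<omega>. Z (?A v) \<omega> * cnj (Z (?B v') \<omega>) \<partial>M))"
    using square_integrable_mult_cnj[OF Zsq[OF s] Zsq[OF s']] by simp
  also have "\<dots> = (\<Sum>v\<in>s ` freq. \<Sum>v'\<in>s' ` freq. v * cnj v' * F (?A v \<times> ?B v'))"
    using Z level_set_borel[OF s] level_set_borel[OF s'] by (simp add: random_measure_def)
  also have "\<dots> = (\<Sum>b\<in>?L. \<Sum>v\<in>s ` freq. \<Sum>v'\<in>s' ` freq. v * cnj v' *
      (LINT \<mu>:freq|lborel. indicator (?A v) (wrap (\<mu> + b)) * indicator (?B v') \<mu> * f b \<mu>))"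
    unfolding Fint sum_distrib_left
    by (subst (2) sum.swap, subst sum.swap) simp
  also have "\<dots> = (\<Sum>b\<in>?L. LINT \<mu>:freq|lborel. s (wrap (\<mu> + b)) * cnj (s' \<mu>) * f b \<mu>)"
  proof (rule sum.cong[OF refl])
    fix b assume b: "b \<in> ?L"
    have "(\<Sum>v\<in>s ` freq. \<Sum>v'\<in>s' ` freq. v * cnj v' *
        (LINT \<mu>:freq|lborel. indicator (?A v) (wrap (\<mu> + b)) * indicator (?B v') \<mu> * f b \<mu>))
      = (LINT \<mu>:freq|lborel. (\<Sum>v\<in>s ` freq. \<Sum>v'\<in>s' ` freq. v * cnj v' *
          (indicator (?A v) (wrap (\<mu> + b)) * indicator (?B v') \<mu> * f b \<mu>)))"
      using int[OF b level_set_borel[OF s] level_set_borel[OF s']]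
      unfolding set_lebesgue_integral_def set_integrable_def
      by (simp add: scaleR_sum_right mult_scaleR_right[symmetric] del: mult_scaleR_right)
    also have "\<dots> = (LINT \<mu>:freq|lborel. s (wrap (\<mu> + b)) * cnj (s' \<mu>) * f b \<mu>)"
    proof (rule set_lebesgue_integral_cong)
      show "\<forall>\<mu>. \<mu> \<in> freq \<longrightarrow> (\<Sum>v\<in>s ` freq. \<Sum>v'\<in>s' ` freq. v * cnj v' *
          (indicator (?A v) (wrap (\<mu> + b)) * indicator (?B v') \<mu> * f b \<mu>))
          = s (wrap (\<mu> + b)) * cnj (s' \<mu>) * f b \<mu>"
      proof (intro allI impI)
        fix \<mu> assume \<mu>: "\<mu> \<in> freq"
        have cnj_s': "(\<Sum>v'\<in>s' ` freq. cnj v' * indicator (?B v') \<mu>) = cnj (s' \<mu>)"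
        proof -
          have "cnj (indicator A \<mu>) = indicator A \<mu>" for A :: "real set" by (simp add: indicator_def)
          then show ?thesis using arg_cong[OF sum_level_sets[OF s' \<mu>], of cnj] by simp
        qed
        show "(\<Sum>v\<in>s ` freq. \<Sum>v'\<in>s' ` freq. v * cnj v' *
          (indicator (?A v) (wrap (\<mu> + b)) * indicator (?B v') \<mu> * f b \<mu>))
          = s (wrap (\<mu> + b)) * cnj (s' \<mu>) * f b \<mu>"
          unfolding cnj_s'[symmetric] sum_level_sets[OF s wrap_in_freq, symmetric, of "\<mu> + b"]
          by (simp add: sum_product sum_distrib_left sum_distrib_right mult_ac)
      qed
    qed simp
    finally show "(\<Sum>v\<in>s ` freq. \<Sum>v'\<in>s' ` freq. v * cnj v' *
        (LINT \<mu>:freq|lborel. indicator (?A v) (wrap (\<mu> + b)) * indicator (?B v') \<mu> * f b \<mu>))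
      = (LINT \<mu>:freq|lborel. s (wrap (\<mu> + b)) * cnj (s' \<mu>) * f b \<mu>)" .
  qed
  finally show "(\<integral>\<omega>. simple_stochastic_integral Z s \<omega> * cnj (simple_stochastic_integral Z s' \<omega>) \<partial>M)
      = (\<Sum>b\<in>?L. LINT \<mu>:freq|lborel. s (wrap (\<mu> + b)) * cnj (s' \<mu>) * f b \<mu>)" .
qed

lemma uniform_limit_eventually_bounded:
  assumes u: "uniform_limit S s g sequentially" and g: "\<And>x. x \<in> S \<Longrightarrow> norm (g x) \<le> 1"
  obtains N where "\<And>n x. n \<ge> N \<Longrightarrow> x \<in> S \<Longrightarrow> norm (s n x) \<le> 2"
proof -
  from uniform_limitD[OF u zero_less_one] obtain N where
    N: "\<And>n x. n \<ge> N \<Longrightarrow> x \<in> S \<Longrightarrow> dist (s n x) (g x) < 1"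
    by (auto simp: eventually_sequentially)
  have "norm (s n x) \<le> 2" if "n \<ge> N" "x \<in> S" for n x
    using N[OF that] g[OF that(2)] norm_triangle_ineq2[of "s n x" "g x"] by (simp add: dist_norm)
  then show ?thesis by (rule that)
qed

text \<open>
  Both sides are limits along simple functions approximating \<open>e\<^bsup>ikt\<^esup>\<close> and \<open>e\<^bsup>imt\<^esup>\<close> uniformly: the left by
  mean-square convergence, the right by dominated convergence on each of the finitely many lines.
\<close>

theorem covariance_eq_sum_line_coeff:
  assumes X: "harmonizable M X F" and F: "has_line_densities F f" and fin: "finite (spectral_lines f)"
  shows "of_real (covariance M X k m)
    = (\<Sum>b\<in>spectral_lines f. exp (\<i> * of_int k * of_real b) * line_coeff f b (k - m))"
proof -
  let ?L = "spectral_lines f"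
  define e where "e k t = exp (\<i> * of_int k * of_real t)" for k :: int and t :: real
  obtain Z where Z: "random_measure M Z F"
    and ZX: "\<And>k. has_stochastic_integral M Z (e k) (\<lambda>\<omega>. of_real (X k \<omega>))"
    using X unfolding harmonizable_def e_def by blast
  have [measurable]: "X k \<in> borel_measurable M" for k
    using X unfolding harmonizable_def by blast
  have XL2: "square_integrable M (\<lambda>\<omega>. of_real (X k \<omega>))" for k
    using X by (simp add: harmonizable_def square_integrable_def)
  obtain s where s: "\<And>n. simple_function borel (s n)" and us: "uniform_limit freq s (e k) sequentially"
    and Ls: "(\<lambda>n. \<integral>\<omega>. (cmod (of_real (X k \<omega>) - simple_stochastic_integral Z (s n) \<omega>))\<^sup>2 \<partial>M) \<longlonglongrightarrow> 0"
    using ZX[of k] unfolding has_stochastic_integral_def by auto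
  obtain s' where s': "\<And>n. simple_function borel (s' n)" and us': "uniform_limit freq s' (e m) sequentially"
    and Ls': "(\<lambda>n. \<integral>\<omega>. (cmod (of_real (X m \<omega>) - simple_stochastic_integral Z (s' n) \<omega>))\<^sup>2 \<partial>M) \<longlonglongrightarrow> 0"
    using ZX[of m] unfolding has_stochastic_integral_def by auto
  note inner = simple_stochastic_integral_inner[OF Z F fin]
  have norm_e: "norm (e k t) \<le> 1" for k t
    by (simp add: e_def norm_exp_eq_Re)
  have lim1: "(\<lambda>n. \<Sum>b\<in>?L. LINT \<mu>:freq|lborel. s n (wrap (\<mu> + b)) * cnj (s' n \<mu>) * f b \<mu>)
      \<longlonglongrightarrow> (\<integral>\<omega>. of_real (X k \<omega>) * cnj (of_real (X m \<omega>)) \<partial>M)"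
    using mean_square_inner_tendsto[OF inner(1)[OF s s] inner(1)[OF s' s'] XL2 XL2 Ls Ls']
    unfolding inner(2)[OF s s'] .
  have lim2: "(\<lambda>n. \<Sum>b\<in>?L. LINT \<mu>:freq|lborel. s n (wrap (\<mu> + b)) * cnj (s' n \<mu>) * f b \<mu>)
      \<longlonglongrightarrow> (\<Sum>b\<in>?L. LINT \<mu>:freq|lborel. e k (wrap (\<mu> + b)) * cnj (e m \<mu>) * f b \<mu>)"
  proof (rule tendsto_sum)
    fix b assume b: "b \<in> ?L"
    have f: "set_integrable lborel freq (f b)" using F b by (simp add: has_line_densities_def)
    then have fm [measurable]: "(\<lambda>\<mu>. indicator freq \<mu> *\<^sub>R f b \<mu>) \<in> borel_measurable lborel"
      unfolding set_integrable_def by (rule borel_measurable_integrable)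
    obtain N where N: "\<And>n x. n \<ge> N \<Longrightarrow> x \<in> freq \<Longrightarrow> norm (s n x) \<le> 2"
      using uniform_limit_eventually_bounded[OF us norm_e] by blast
    obtain N' where N': "\<And>n x. n \<ge> N' \<Longrightarrow> x \<in> freq \<Longrightarrow> norm (s' n x) \<le> 2"
      using uniform_limit_eventually_bounded[OF us' norm_e] by blast
    have pw: "(\<lambda>n. s n x) \<longlonglongrightarrow> e k x" "(\<lambda>n. s' n x) \<longlonglongrightarrow> e m x" if "x \<in> freq" for x
      using tendsto_uniform_limitI[OF us that] tendsto_uniform_limitI[OF us' that] by auto
    have sm [measurable]: "s n \<in> borel_measurable borel" "s' n \<in> borel_measurable borel" for n
      using s s' by (auto intro: borel_measurable_simple_function)
    have em [measurable]: "e k \<in> borel_measurable borel" for k unfolding e_def by measurable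
    have cnj_m [measurable]: "cnj \<in> borel_measurable borel"
      by (intro borel_measurable_continuous_onI continuous_intros)
    show "(\<lambda>n. LINT \<mu>:freq|lborel. s n (wrap (\<mu> + b)) * cnj (s' n \<mu>) * f b \<mu>)
        \<longlonglongrightarrow> (LINT \<mu>:freq|lborel. e k (wrap (\<mu> + b)) * cnj (e m \<mu>) * f b \<mu>)"
      unfolding set_lebesgue_integral_def mult_scaleR_right[symmetric]
    \<comment> \<open>From the index \<open>max N N'\<close> on, both simple functions are bounded by \<open>2\<close>, which gives the dominating function.\<close>
    proof (rule LIMSEQ_offset[of _ "max N N'"], rule integral_dominated_convergence)
      show "integrable lborel (\<lambda>\<mu>. 4 * norm (indicator freq \<mu> *\<^sub>R f b \<mu>))"
        using f unfolding set_integrable_def by (intro integrable_mult_right integrable_norm)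
      show "(\<lambda>\<mu>. e k (wrap (\<mu> + b)) * cnj (e m \<mu>) * (indicator freq \<mu> *\<^sub>R f b \<mu>)) \<in> borel_measurable lborel"
        by measurable
      show "(\<lambda>\<mu>. s (n + max N N') (wrap (\<mu> + b)) * cnj (s' (n + max N N') \<mu>)
          * (indicator freq \<mu> *\<^sub>R f b \<mu>)) \<in> borel_measurable lborel" for n
        by measurable
      show "AE \<mu> in lborel. (\<lambda>n. s (n + max N N') (wrap (\<mu> + b)) * cnj (s' (n + max N N') \<mu>)
          * (indicator freq \<mu> *\<^sub>R f b \<mu>))
          \<longlonglongrightarrow> e k (wrap (\<mu> + b)) * cnj (e m \<mu>) * (indicator freq \<mu> *\<^sub>R f b \<mu>)"
      proof (rule AE_I2)
        fix \<mu>
        show "(\<lambda>n. s (n + max N N') (wrap (\<mu> + b)) * cnj (s' (n + max N N') \<mu>)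
          * (indicator freq \<mu> *\<^sub>R f b \<mu>))
          \<longlonglongrightarrow> e k (wrap (\<mu> + b)) * cnj (e m \<mu>) * (indicator freq \<mu> *\<^sub>R f b \<mu>)"
        proof (cases "\<mu> \<in> freq")
          case True
          then show ?thesis
            by (intro tendsto_intros LIMSEQ_ignore_initial_segment pw wrap_in_freq)
        next
          case False
          then have "indicator freq \<mu> = (0::real)" by (rule indicator_simps(2))
          then have 0: "indicator freq \<mu> *\<^sub>R f b \<mu> = 0" by (simp only: scaleR_zero_left)
          show ?thesis unfolding 0 by simp
        qed
      qed
      show "AE \<mu> in lborel. norm (s (n + max N N') (wrap (\<mu> + b)) * cnj (s' (n + max N N') \<mu>)
          * (indicator freq \<mu> *\<^sub>R f b \<mu>)) \<le> 4 * norm (indicator freq \<mu> *\<^sub>R f b \<mu>)" for n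
      proof (rule AE_I2)
        fix \<mu>
        show "norm (s (n + max N N') (wrap (\<mu> + b)) * cnj (s' (n + max N N') \<mu>)
          * (indicator freq \<mu> *\<^sub>R f b \<mu>)) \<le> 4 * norm (indicator freq \<mu> *\<^sub>R f b \<mu>)"
        proof (cases "\<mu> \<in> freq")
          case True
          have "norm (s (n + max N N') (wrap (\<mu> + b))) * norm (s' (n + max N N') \<mu>) \<le> 2 * 2"
            using N[OF _ wrap_in_freq] N'[OF _ True] by (intro mult_mono) auto
          then have "norm (s (n + max N N') (wrap (\<mu> + b)) * cnj (s' (n + max N N') \<mu>)) \<le> 4"
            by (simp add: norm_mult)
          then show ?thesis
            unfolding norm_mult[of _ "_ *\<^sub>R _"] by (rule mult_right_mono) (rule norm_ge_zero)
        qed simp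
      qed
    qed
  qed
  have "of_real (covariance M X k m) = (\<integral>\<omega>. of_real (X k \<omega>) * cnj (of_real (X m \<omega>)) \<partial>M :: complex)"
    unfolding covariance_def by (simp flip: of_real_mult)
  also have "\<dots> = (\<Sum>b\<in>?L. LINT \<mu>:freq|lborel. e k (wrap (\<mu> + b)) * cnj (e m \<mu>) * f b \<mu>)"
    by (rule LIMSEQ_unique[OF lim1 lim2])
  also have "\<dots> = (\<Sum>b\<in>?L. exp (\<i> * of_int k * of_real b) * line_coeff f b (k - m))"
  proof (rule sum.cong[OF refl])
    fix b
    have "e k (wrap (\<mu> + b)) * cnj (e m \<mu>)
        = exp (\<i> * of_int k * of_real b) * exp (\<i> * of_int (k - m) * of_real \<mu>)" for \<mu>
      unfolding e_def exp_wrap by (simp add: exp_cnj exp_add[symmetric] algebra_simps)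
    then show "(LINT \<mu>:freq|lborel. e k (wrap (\<mu> + b)) * cnj (e m \<mu>) * f b \<mu>)
        = exp (\<i> * of_int k * of_real b) * line_coeff f b (k - m)"
      unfolding line_coeff_def by (simp add: mult.assoc set_integral_mult_right)
  qed
  finally show ?thesis .
qed

lemma covariance_sym: "covariance M X k m = covariance M X m k"
  by (simp add: covariance_def mult.commute)

lemma abs_covariance_le:
  assumes "harmonizable M X F" "has_line_densities F f" "finite (spectral_lines f)"
    and dom: "\<And>b j. b \<in> spectral_lines f \<Longrightarrow> cmod (line_coeff f b j) \<le> c j"
  shows "\<bar>covariance M X k m\<bar> \<le> real (card (spectral_lines f)) * c (k - m)"
proof -
  have "\<bar>covariance M X k m\<bar> = cmod (of_real (covariance M X k m))" by simp
  also have "\<dots> \<le> (\<Sum>b\<in>spectral_lines f. cmod (exp (\<i> * of_int k * of_real b) * line_coeff f b (k - m)))"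
    unfolding covariance_eq_sum_line_coeff[OF assms(1-3)] by (rule norm_sum)
  also have "\<dots> \<le> (\<Sum>b\<in>spectral_lines f. c (k - m))"
    using dom by (intro sum_mono) (simp add: norm_mult norm_exp_eq_Re)
  finally show ?thesis by simp
qed

lemma covariance_row_sum_le:
  assumes H: "harmonizable M X F" "has_line_densities F f" "finite (spectral_lines f)"
    and c: "\<And>j. 0 \<le> c j"
    and dom: "\<And>b j. b \<in> spectral_lines f \<Longrightarrow> cmod (line_coeff f b j) \<le> c j"
    and summ: "c summable_on UNIV" and I: "finite I"
  shows "(\<Sum>m\<in>I. \<bar>covariance M X k m\<bar>) \<le> real (card (spectral_lines f)) * (\<Sum>\<^sub>\<infinity>j. c j)"
proof -
  have "(\<Sum>m\<in>I. \<bar>covariance M X k m\<bar>) \<le> (\<Sum>m\<in>I. real (card (spectral_lines f)) * c (k - m))"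
    using abs_covariance_le[OF H dom] by (intro sum_mono) auto
  also have "\<dots> = real (card (spectral_lines f)) * (\<Sum>j\<in>(\<lambda>m. k - m) ` I. c j)"
    by (simp add: sum.reindex inj_on_def sum_distrib_left)
  also have "\<dots> \<le> real (card (spectral_lines f)) * (\<Sum>\<^sub>\<infinity>j. c j)"
    using I c by (intro mult_left_mono finite_sum_le_infsum[OF summ]) auto
  finally show ?thesis .
qed

section \<open>Finite-dimensional laws of a Gaussian process\<close>

lemma (in prob_space) char_centred_gaussian_rv:
  assumes Y: "gaussian_rv M Y" "integrable M Y" "expectation Y = 0"
  shows "(CLINT \<omega>|M. iexp (Y \<omega>)) = of_real (exp (- (expectation (\<lambda>\<omega>. (Y \<omega>)\<^sup>2)) / 2))"
proof -
  have [measurable]: "Y \<in> borel_measurable M" using Y by (simp add: gaussian_rv_def)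
  obtain m where "distr M borel Y = return borel m \<or>
      (\<exists>\<sigma>>0. distr M borel Y = density lborel (normal_density m \<sigma>))"
    using Y by (auto simp: gaussian_rv_def)
  then show ?thesis
  proof
    assume D: "distr M borel Y = return borel m"
    have *: "(\<integral>\<omega>. g (Y \<omega>) \<partial>M) = g m" if [measurable]: "g \<in> borel_measurable borel"
      for g :: "real \<Rightarrow> 'b::{banach, second_countable_topology}"
    proof -
      have "(\<integral>\<omega>. g (Y \<omega>) \<partial>M) = (\<integral>y. g y \<partial>distr M borel Y)" by (subst integral_distr) auto
      also have "\<dots> = g m" unfolding D by (subst integral_return) auto
      finally show ?thesis .
    qed
    have "m = 0" using *[of "\<lambda>y. y"] Y by simp
    then show ?thesis using *[of "\<lambda>y. y\<^sup>2"] *[of "\<lambda>y. iexp y"] by simp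
  next
    assume "\<exists>\<sigma>>0. distr M borel Y = density lborel (normal_density m \<sigma>)"
    then obtain \<sigma> where \<sigma>: "0 < \<sigma>" and D: "distr M borel Y = density lborel (normal_density m \<sigma>)" by auto
    have dist: "distributed M lborel Y (normal_density m \<sigma>)"
      using D by (simp add: distributed_def cong: distr_cong)
    have m: "m = 0" using normal_distributed_expectation[OF \<sigma> dist] Y by simp
    have var: "expectation (\<lambda>\<omega>. (Y \<omega>)\<^sup>2) = \<sigma>\<^sup>2"
      using normal_distributed_variance[OF \<sigma> dist] Y by simp
    have "distributed M lborel (\<lambda>\<omega>. Y \<omega> / \<sigma>) std_normal_density"
      using dist normal_standard_normal_convert[OF \<sigma>, of Y m] m by simp
    then have D': "distr M borel (\<lambda>\<omega>. Y \<omega> / \<sigma>) = std_normal_distribution"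
      by (simp add: distributed_def cong: distr_cong)
    have "(CLINT \<omega>|M. iexp (Y \<omega>)) = (CLINT \<omega>|M. iexp (\<sigma> * (Y \<omega> / \<sigma>)))"
      using \<sigma> by simp
    also have "\<dots> = char (distr M borel (\<lambda>\<omega>. Y \<omega> / \<sigma>)) \<sigma>"
      unfolding char_def by (subst integral_distr) auto
    finally show ?thesis
      unfolding D' char_std_normal_distribution var by simp
  qed
qed

lemma (in prob_space) char_gaussian_process:
  assumes mz: "mean_zero M X" and G: "gaussian_process M X"
    and X: "\<And>k. X k \<in> borel_measurable M" "\<And>k. integrable M (\<lambda>\<omega>. (X k \<omega>)\<^sup>2)"
    and I: "finite I"
  shows "(CLINT \<omega>|M. iexp (\<Sum>i\<in>I. t i * X i \<omega>)) = of_real (exp (- quad_form I (covariance M X) t / 2))"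
proof -
  have sq: "square_integrable M (\<lambda>\<omega>. of_real (X k \<omega>))" for k
    using X[of k] by (simp add: square_integrable_def)
  have XX: "integrable M (\<lambda>\<omega>. X i \<omega> * X j \<omega>)" for i j
    using square_integrable_mult_cnj[OF sq[of i] sq[of j]]
    by (simp add: complex_of_real_integrable_eq flip: of_real_mult)
  define Y where "Y \<omega> = (\<Sum>i\<in>I. t i * X i \<omega>)" for \<omega>
  have "gaussian_rv M Y" using G I by (simp add: gaussian_process_def Y_def[abs_def])
  moreover have "integrable M Y" "expectation Y = 0"
    using mz by (auto simp: mean_zero_def Y_def[abs_def])
  moreover have "expectation (\<lambda>\<omega>. (Y \<omega>)\<^sup>2) = quad_form I (covariance M X) t"
  proof -
    have "expectation (\<lambda>\<omega>. (Y \<omega>)\<^sup>2)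
        = expectation (\<lambda>\<omega>. \<Sum>i\<in>I. \<Sum>j\<in>I. (t i * t j) * (X i \<omega> * X j \<omega>))"
      by (simp add: Y_def power2_eq_square sum_product mult_ac)
    also have "\<dots> = (\<Sum>i\<in>I. \<Sum>j\<in>I. (t i * t j) * expectation (\<lambda>\<omega>. X i \<omega> * X j \<omega>))"
      using XX by simp
    finally show ?thesis by (simp add: quad_form_def covariance_def mult_ac)
  qed
  ultimately show ?thesis
    using char_centred_gaussian_rv[of Y] by (simp add: Y_def[abs_def])
qed

section \<open>From trigonometric sums to finitely many linear forms\<close>

lemma V_eq_sum:
  assumes "\<And>k. integrable M (\<lambda>\<omega>. (X k \<omega>)\<^sup>2)"
  shows "V M X n w \<omega> = (\<Sum>k = - (int n div 2)..int n div 2.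
    of_real ((X k \<omega>)\<^sup>2 - covariance M X k k) * exp (- \<i> * of_real w * of_int k))"
proof -
  let ?I = "{- (int n div 2)..int n div 2}" and ?e = "\<lambda>k. exp (- \<i> * of_real w * of_int k)"
  have int: "integrable M (\<lambda>\<omega>. complex_of_real ((X k \<omega>)\<^sup>2))" for k
    using assms[of k] by (simp only: complex_of_real_integrable_eq)
  have "(\<integral>\<omega>. U X n w \<omega> \<partial>M) = 1 / of_nat (n + 1) * (\<Sum>k\<in>?I. (\<integral>\<omega>. of_real ((X k \<omega>)\<^sup>2) \<partial>M) * ?e k)"
    unfolding U_def using int by (simp del: of_real_power)
  also have "\<dots> = 1 / of_nat (n + 1) * (\<Sum>k\<in>?I. of_real (covariance M X k k) * ?e k)"
    by (simp only: integral_complex_of_real covariance_def power2_eq_square)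
  finally have EU: "(\<integral>\<omega>. U X n w \<omega> \<partial>M) = 1 / of_nat (n + 1) * (\<Sum>k\<in>?I. of_real (covariance M X k k) * ?e k)" .
  have "complex_of_nat (n + 1) \<noteq> 0" by (simp only: of_nat_eq_0_iff)
  moreover have "N * (1 / N * A - 1 / N * B) = A - B" if "N \<noteq> 0" for N A B :: complex
    using that by (simp add: right_diff_distrib)
  ultimately show ?thesis
    unfolding V_def EU unfolding U_def by (simp only: sum_subtractf left_diff_distrib of_real_diff)
qed

lemma cmod_exp_i_diff_le: "cmod (exp (- \<i> * of_real a) - exp (- \<i> * of_real b)) \<le> \<bar>a - b\<bar>"
proof -
  have "exp (- \<i> * of_real a) - exp (- \<i> * of_real b) = exp (- \<i> * of_real b) * (iexp (b - a) - 1)"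
    by (simp add: algebra_simps flip: exp_add)
  then have "cmod (exp (- \<i> * of_real a) - exp (- \<i> * of_real b)) = cmod (iexp (b - a) - 1)"
    by (simp add: norm_mult norm_exp_eq_Re)
  also have "\<dots> \<le> \<bar>b - a\<bar>" using iexp_approx1[of "b - a" 0] by simp
  finally show ?thesis by (simp add: abs_minus_commute)
qed

text \<open>
  At a grid point the real and the imaginary part are at most \<open>x\<close>, so the modulus is at most
  \<open>\<surd>2 x\<close>. Between grid points the sum is Lipschitz with constant \<open>\<Sum> \<bar>k\<bar> \<bar>v\<^sub>k\<bar> \<le> (2h + 1) h x\<close>. By
  \<open>2\<pi>\<close>-periodicity finitely many grid points serve all real \<open>w\<close>.
\<close>

lemma trig_sum_le_on_grid:
  fixes v :: "int \<Rightarrow> real" and h K :: nat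
  assumes K: "0 < K" and x: "0 \<le> x"
    and coeff: "\<And>k. k \<in> {- int h..int h} \<Longrightarrow> \<bar>v k\<bar> \<le> x"
    and cos: "\<And>j. j < K \<Longrightarrow> \<bar>\<Sum>k = - int h..int h. cos (of_int k * (2 * pi * real j / real K)) * v k\<bar> \<le> x"
    and sin: "\<And>j. j < K \<Longrightarrow> \<bar>\<Sum>k = - int h..int h. sin (of_int k * (2 * pi * real j / real K)) * v k\<bar> \<le> x"
  shows "cmod (\<Sum>k = - int h..int h. of_real (v k) * exp (- \<i> * of_real w * of_int k))
    \<le> (sqrt 2 + (2 * real h + 1) * real h * (2 * pi / real K)) * x"
proof -
  let ?I = "{- int h..int h}"
  define p where "p w = (\<Sum>k\<in>?I. of_real (v k) * exp (- \<i> * of_real w * of_int k))" for w :: real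
  \<comment> \<open>\<open>w0\<close> is the largest multiple of \<open>2\<pi>/K\<close> not above \<open>w\<close>, and \<open>wj\<close> its representative in \<open>[0, 2\<pi>)\<close>.\<close>
  define z where "z = \<lfloor>w * real K / (2 * pi)\<rfloor>"
  define j where "j = nat (z mod int K)"
  define w0 where "w0 = 2 * pi * of_int z / real K"
  define wj where "wj = 2 * pi * real j / real K"
  have j: "j < K" using K by (simp add: j_def nat_less_iff)
  have w0: "\<bar>w - w0\<bar> \<le> 2 * pi / real K"
  proof -
    have "\<bar>w * real K / (2 * pi) - of_int z\<bar> \<le> 1" unfolding z_def by linarith
    then have "\<bar>w * real K / (2 * pi) - of_int z\<bar> * (2 * pi / real K) \<le> 2 * pi / real K"
      using K by (intro mult_left_le_one_le) auto
    moreover have "w - w0 = (w * real K / (2 * pi) - of_int z) * (2 * pi / real K)"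
      using K by (simp add: w0_def field_simps)
    ultimately show ?thesis using K by (simp add: abs_mult)
  qed
  have per: "p w0 = p wj"
  proof -
    have "z = int j + int K * (z div int K)" using K by (simp add: j_def)
    then have "of_int z = real j + real K * of_int (z div int K)"
      by (metis of_int_add of_int_mult of_int_of_nat_eq)
    then have "w0 = wj + 2 * pi * of_int (z div int K)"
      using K by (simp add: w0_def wj_def field_simps)
    then have "exp (- \<i> * of_real w0 * of_int k) = exp (- \<i> * of_real wj * of_int k)" for k
      using exp_plus_2pin[of "- \<i> * of_real wj * of_int k" "- (z div int K) * k"]
      by (simp add: algebra_simps)
    then show ?thesis by (simp add: p_def)
  qed
  have grid: "cmod (p wj) \<le> sqrt 2 * x"
  proof -
    have e: "exp (- \<i> * of_real wj * of_int k) = Complex (cos (of_int k * wj)) (- sin (of_int k * wj))" for k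
      using cis_conv_exp[of "- (of_int k * wj)"] by (simp add: cis.code mult_ac)
    have Re: "Re (p wj) = (\<Sum>k\<in>?I. cos (of_int k * wj) * v k)"
      and Im: "Im (p wj) = - (\<Sum>k\<in>?I. sin (of_int k * wj) * v k)"
      unfolding p_def e by (simp_all add: mult.commute sum_negf)
    have "(Re (p wj))\<^sup>2 \<le> x\<^sup>2" "(Im (p wj))\<^sup>2 \<le> x\<^sup>2"
      using cos[OF j, folded wj_def] sin[OF j, folded wj_def] x
      unfolding Re Im by (simp_all add: power2_le_iff_abs_le)
    then have "cmod (p wj) \<le> sqrt (2 * x\<^sup>2)" unfolding cmod_def by (intro real_sqrt_le_mono) simp
    then show ?thesis using x by (simp add: real_sqrt_mult)
  qed
  have "cmod (p w - p w0) \<le> (\<Sum>k\<in>?I. x * (real h * (2 * pi / real K)))"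
    unfolding p_def sum_subtractf[symmetric] right_diff_distrib[symmetric]
  proof (rule order_trans[OF norm_sum sum_mono])
    fix k assume k: "k \<in> ?I"
    have "cmod (exp (- \<i> * of_real w * of_int k) - exp (- \<i> * of_real w0 * of_int k)) \<le> \<bar>w * of_int k - w0 * of_int k\<bar>"
      using cmod_exp_i_diff_le[of "w * of_int k" "w0 * of_int k"] by (simp add: mult.assoc)
    also have "\<dots> = \<bar>of_int k\<bar> * \<bar>w - w0\<bar>"
      by (simp add: abs_mult[symmetric] algebra_simps)
    also have "\<dots> \<le> real h * (2 * pi / real K)"
      using w0 k by (intro mult_mono) auto
    finally show "cmod (of_real (v k) * (exp (- \<i> * of_real w * of_int k) - exp (- \<i> * of_real w0 * of_int k)))
        \<le> x * (real h * (2 * pi / real K))"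
      unfolding norm_mult using coeff[OF k] x by (intro mult_mono) auto
  qed
  also have "\<dots> = (2 * real h + 1) * real h * (2 * pi / real K) * x"
    by simp
  finally have "cmod (p w - p w0) \<le> (2 * real h + 1) * real h * (2 * pi / real K) * x" .
  moreover have "cmod (p w) \<le> cmod (p w0) + cmod (p w - p w0)"
    using norm_triangle_ineq[of "p w0" "p w - p w0"] by simp
  ultimately show ?thesis
    using grid unfolding per p_def[symmetric] by (simp add: algebra_simps)
qed

section \<open>The almost sure bound\<close>

text \<open>
  With \<open>x = 4 \<sigma> (n log n)\<^bsup>1/2\<^esup>\<close>, the value of \<open>\<theta>\<close> minimises \<open>- \<theta> x + n (\<theta> \<sigma>)\<^sup>2\<close>; the minimum is
  \<open>- 8 log n + 4 log n\<close>. The remaining terms are of order \<open>log n / n\<close> and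
  \<open>n (log n / n)\<^bsup>3/2\<^esup>\<close>, and tend to \<open>0\<close>.
\<close>

lemma chernoff_exponent_eventually:
  assumes \<sigma>: "0 < \<sigma>"
  shows "\<forall>\<^sub>F h :: nat in sequentially. let n = 2 * real h; \<theta> = 2 * sqrt (ln n / n) / \<sigma> in
    0 \<le> \<theta> \<and> \<theta> * \<sigma> \<le> 1 / 16 \<and>
    - \<theta> * (4 * \<sigma> * sqrt (n * ln n)) + (n + 1) * ((\<theta> * \<sigma>)\<^sup>2 + 52 * (\<theta> * \<sigma>) ^ 3) \<le> 1 - 4 * ln n"
proof -
  have "\<forall>\<^sub>F h :: nat in sequentially. 2 * sqrt (ln (2 * real h) / (2 * real h)) \<le> 1 / 16"
    by real_asymp
  moreover have "\<forall>\<^sub>F h :: nat in sequentially.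
      4 * (ln (2 * real h) / (2 * real h)) + (2 * real h + 1) * (416 * sqrt (ln (2 * real h) / (2 * real h)) ^ 3) \<le> 1"
    by real_asymp
  ultimately show ?thesis
    using eventually_gt_at_top[of 0]
  proof eventually_elim
    case (elim h)
    define n where "n = 2 * real h"
    define q where "q = sqrt (ln n / n)"
    have n: "2 \<le> n" using elim by (simp add: n_def)
    have ln: "0 \<le> ln n" using n by simp
    have q2: "q\<^sup>2 = ln n / n" using n ln by (simp add: q_def)
    have qn: "q * sqrt (n * ln n) = ln n"
    proof -
      have "q * sqrt (n * ln n) = sqrt (ln n / n * (n * ln n))" by (simp only: q_def real_sqrt_mult)
      also have "ln n / n * (n * ln n) = (ln n)\<^sup>2" using n by (simp add: power2_eq_square)
      finally show ?thesis using ln by simp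
    qed
    have \<theta>: "2 * q / \<sigma> * \<sigma> = 2 * q" using \<sigma> by simp
    have "- (2 * q / \<sigma>) * (4 * \<sigma> * sqrt (n * ln n)) = - 8 * (q * sqrt (n * ln n))"
      using \<sigma> by simp
    also have "\<dots> = - 8 * ln n" by (simp only: qn)
    finally have "- (2 * q / \<sigma>) * (4 * \<sigma> * sqrt (n * ln n)) = - 8 * ln n" .
    moreover have "(n + 1) * (2 * q)\<^sup>2 = 4 * ln n + 4 * (ln n / n)"
      using n by (simp add: power_mult_distrib q2 field_simps)
    moreover have "4 * (ln n / n) + (n + 1) * (416 * q ^ 3) \<le> 1"
      using elim by (simp only: n_def[symmetric] q_def[symmetric])
    moreover have "(n + 1) * ((2 * q)\<^sup>2 + 52 * (2 * q) ^ 3) = (n + 1) * (2 * q)\<^sup>2 + (n + 1) * (416 * q ^ 3)"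
      by (simp add: algebra_simps power_mult_distrib)
    ultimately have "- (2 * q / \<sigma>) * (4 * \<sigma> * sqrt (n * ln n)) + (n + 1) * ((2 * q)\<^sup>2 + 52 * (2 * q) ^ 3)
        \<le> 1 - 4 * ln n" by linarith
    moreover have "0 \<le> 2 * q / \<sigma>" using \<sigma> ln n by (simp add: q_def)
    moreover have "2 * q \<le> 1 / 16" using elim by (simp only: n_def[symmetric] q_def[symmetric])
    ultimately show ?case
      unfolding Let_def n_def[symmetric] q_def[symmetric] \<theta> by blast
  qed
qed

text \<open>
  The linear forms in the \<open>\<xi>\<^sub>k\<close> that have to be controlled: real and imaginary parts of the
  trigonometric sum at \<open>K\<close> equidistant frequencies, and the single coefficients.
\<close>

definition test_weights :: "nat \<Rightarrow> nat \<Rightarrow> (int \<Rightarrow> real) set" where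
  "test_weights h K =
     (\<lambda>j k. cos (of_int k * (2 * pi * real j / real K))) ` {..<K} \<union>
     (\<lambda>j k. sin (of_int k * (2 * pi * real j / real K))) ` {..<K} \<union>
     (\<lambda>l k. of_bool (k = l)) ` {- int h..int h}"

lemma test_weights:
  "finite (test_weights h K)" "card (test_weights h K) \<le> 2 * K + (2 * h + 1)"
  "a \<in> test_weights h K \<Longrightarrow> \<bar>a k\<bar> \<le> 1"
proof -
  show "finite (test_weights h K)" by (simp add: test_weights_def)
  have "card (test_weights h K) \<le> card {..<K} + card {..<K} + card {- int h..int h}"
    unfolding test_weights_def
    by (intro order_trans[OF card_Un_le] add_mono card_image_le) auto
  also have "card {- int h..int h} = 2 * h + 1" by simp
  finally show "card (test_weights h K) \<le> 2 * K + (2 * h + 1)" by simp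
  show "\<bar>a k\<bar> \<le> 1" if "a \<in> test_weights h K" for a k
    using that by (auto simp: test_weights_def)
qed

text \<open>
  With \<open>L n\<^sup>2\<close> grid frequencies the Lipschitz error is at most \<open>5/L\<close> times the threshold, while the
  union bound over \<open>O(n\<^sup>2)\<close> forms of tail probability \<open>O(n\<^bsup>-4\<^esup>)\<close> is summable in \<open>n = 2 h\<close>.
\<close>

lemma (in prob_space) limsup_sup_V_le:
  fixes X :: "int \<Rightarrow> 'a \<Rightarrow> real" and L :: nat
  assumes X [measurable]: "\<And>k. X k \<in> borel_measurable M"
    and X2: "\<And>k. integrable M (\<lambda>\<omega>. (X k \<omega>)\<^sup>2)"
    and char: "\<And>I t. finite I \<Longrightarrow> (CLINT \<omega>|M. iexp (\<Sum>i\<in>I. t i * X i \<omega>))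
      = of_real (exp (- quad_form I (covariance M X) t / 2))"
    and row: "\<And>I k. finite I \<Longrightarrow> (\<Sum>m\<in>I. \<bar>covariance M X k m\<bar>) \<le> \<sigma>"
    and \<sigma>: "0 < \<sigma>" and L: "0 < L"
  shows "AE \<omega> in M. limsup (\<lambda>h :: nat. let n = 2 * h in
      SUP w :: real. ereal (cmod (V M X n w \<omega>) / sqrt (real n * ln (real n))))
    \<le> ereal (4 * (sqrt 2 + 5 / real L) * \<sigma>)"
proof -
  let ?r = "covariance M X"
  define x where "x h = 4 * \<sigma> * sqrt (2 * real h * ln (2 * real h))" for h :: nat
  define K where "K h = L * (2 * h)\<^sup>2" for h :: nat
  define S where "S h a \<omega> = (\<Sum>k = - int h..int h. a k * ((X k \<omega>)\<^sup>2 - ?r k k))" for h a \<omega>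
  define A where "A h = (\<Union>a\<in>test_weights h (K h). {\<omega> \<in> space M. x h \<le> \<bar>S h a \<omega>\<bar>})" for h
  have [measurable]: "S h a \<in> borel_measurable M" for h a unfolding S_def by measurable
  have A_meas: "A h \<in> sets M" for h
    unfolding A_def by (intro sets.finite_UN test_weights) measurable
  have A_prob: "\<forall>\<^sub>F h in sequentially. norm (prob (A h)) \<le> ((8 * real L + 3) * exp 1 / 8) * (1 / (real h)\<^sup>2)"
    using chernoff_exponent_eventually[OF \<sigma>] eventually_gt_at_top[of 0]
  proof eventually_elim
    case (elim h)
    define n where "n = 2 * real h"
    define \<theta> where "\<theta> = 2 * sqrt (ln n / n) / \<sigma>"
    have h: "1 \<le> real h" using elim by simp
    have \<theta>: "0 \<le> \<theta>" "\<theta> * \<sigma> \<le> 1 / 16"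
      and exponent: "- \<theta> * x h + (n + 1) * ((\<theta> * \<sigma>)\<^sup>2 + 52 * (\<theta> * \<sigma>) ^ 3) \<le> 1 - 4 * ln n"
      using elim(1) unfolding Let_def x_def n_def[symmetric] \<theta>_def[symmetric] by auto
    have card: "real (card {- int h..int h}) = n + 1" by (simp add: n_def)
    have one: "prob {\<omega> \<in> space M. x h \<le> S h a \<omega>} \<le> exp 1 / n ^ 4" if a: "\<And>k. \<bar>a k\<bar> \<le> 1" for a
    proof -
      have "prob {\<omega> \<in> space M. x h \<le> S h a \<omega>} \<le> exp (- \<theta> * x h + (n + 1) * ((\<theta> * \<sigma>)\<^sup>2 + 52 * (\<theta> * \<sigma>) ^ 3))"
        unfolding card[symmetric] S_def
        by (rule gaussian_squares_tail[OF X finite_atLeastAtMost_int covariance_sym row a _ \<theta> char])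
          (use \<sigma> in auto)
      also have "\<dots> \<le> exp (1 - 4 * ln n)" using exponent by simp
      also have "\<dots> = exp 1 / n ^ 4"
        using h exp_of_nat_mult[of 4 "ln n"] by (simp add: exp_diff n_def)
      finally show ?thesis .
    qed
    have two: "prob {\<omega> \<in> space M. x h \<le> \<bar>S h a \<omega>\<bar>} \<le> 2 * (exp 1 / n ^ 4)"
      if a: "a \<in> test_weights h (K h)" for a
    proof -
      have minus: "S h (\<lambda>k. - a k) \<omega> = - S h a \<omega>" for \<omega>
        by (simp add: S_def sum_negf)
      have "{\<omega> \<in> space M. x h \<le> \<bar>S h a \<omega>\<bar>}
          \<subseteq> {\<omega> \<in> space M. x h \<le> S h a \<omega>} \<union> {\<omega> \<in> space M. x h \<le> S h (\<lambda>k. - a k) \<omega>}"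
        by (auto simp: minus)
      then have "prob {\<omega> \<in> space M. x h \<le> \<bar>S h a \<omega>\<bar>}
          \<le> prob {\<omega> \<in> space M. x h \<le> S h a \<omega>} + prob {\<omega> \<in> space M. x h \<le> S h (\<lambda>k. - a k) \<omega>}"
        by (intro order_trans[OF finite_measure_mono measure_Un_le]) auto
      also have "\<dots> \<le> exp 1 / n ^ 4 + exp 1 / n ^ 4"
        using test_weights(3)[OF a] by (intro add_mono one) auto
      finally show ?thesis by simp
    qed
    have "prob (A h) \<le> (\<Sum>a\<in>test_weights h (K h). prob {\<omega> \<in> space M. x h \<le> \<bar>S h a \<omega>\<bar>})"
      unfolding A_def by (intro measure_UNION_le test_weights) measurable
    also have "\<dots> \<le> real (card (test_weights h (K h))) * (2 * (exp 1 / n ^ 4))"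
      by (rule sum_bounded_above) (rule two)
    also have "\<dots> \<le> (8 * real L + 3) * (real h)\<^sup>2 * (2 * (exp 1 / n ^ 4))"
    proof (intro mult_right_mono)
      have "real (card (test_weights h (K h))) \<le> real (2 * K h + (2 * h + 1))"
        using test_weights(2) by (simp only: of_nat_le_iff)
      also have "\<dots> \<le> 8 * real L * (real h)\<^sup>2 + 3 * (real h)\<^sup>2"
      proof -
        have "real h \<le> (real h)\<^sup>2" using self_le_power[OF h, of 2] by (simp only: pos2)
        moreover have "real (2 * K h + (2 * h + 1)) = 8 * real L * (real h)\<^sup>2 + 2 * real h + 1"
          by (simp add: K_def power_mult_distrib)
        ultimately show ?thesis using h by linarith
      qed
      finally show "real (card (test_weights h (K h))) \<le> (8 * real L + 3) * (real h)\<^sup>2"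
        by (simp add: algebra_simps)
    qed (simp add: n_def)
    also have "\<dots> = ((8 * real L + 3) * exp 1 / 8) * (1 / (real h)\<^sup>2)"
      using h by (simp add: n_def field_simps power2_eq_square power4_eq_xxxx)
    finally show ?case by simp
  qed
  have "summable (\<lambda>h. prob (A h))"
    by (rule summable_comparison_test_ev[OF A_prob], intro summable_mult)
      (use inverse_power_summable[of 2, where ?'a = real] in \<open>simp add: inverse_eq_divide\<close>)
  then have "AE \<omega> in M. \<forall>\<^sub>F h in sequentially. \<omega> \<in> space M - A h"
    using A_meas by (intro borel_cantelli_AE1) (auto simp: emeasure_eq_measure)
  then show ?thesis
  proof eventually_elim
    case (elim \<omega>)
    have "\<forall>\<^sub>F h in sequentially. (let n = 2 * h in
        SUP w :: real. ereal (cmod (V M X n w \<omega>) / sqrt (real n * ln (real n))))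
      \<le> ereal (4 * (sqrt 2 + 5 / real L) * \<sigma>)"
      using elim eventually_gt_at_top[of 0]
    proof eventually_elim
      case (elim h)
      define v where "v k = (X k \<omega>)\<^sup>2 - ?r k k" for k
      have h: "1 \<le> real h" using elim by simp
      have small: "\<bar>\<Sum>k = - int h..int h. a k * v k\<bar> \<le> x h" if "a \<in> test_weights h (K h)" for a
      proof -
        have "\<not> x h \<le> \<bar>S h a \<omega>\<bar>" using elim that by (auto simp: A_def)
        then show ?thesis by (simp add: S_def v_def)
      qed
      have K: "0 < K h" using elim L by (simp add: K_def)
      have x: "0 \<le> x h" using h \<sigma> by (simp add: x_def)
      have norm_pos: "0 < sqrt (2 * real h * ln (2 * real h))" using h by simp
      have "cmod (V M X (2 * h) w \<omega>) / sqrt (2 * real h * ln (2 * real h)) \<le> 4 * (sqrt 2 + 5 / real L) * \<sigma>" for w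
      proof -
        have half: "int (2 * h) div 2 = int h" by simp
        have "cmod (V M X (2 * h) w \<omega>) \<le> (sqrt 2 + (2 * real h + 1) * real h * (2 * pi / real (K h))) * x h"
          unfolding V_eq_sum[OF X2] half v_def[symmetric]
        proof (rule trig_sum_le_on_grid[OF K x])
          show "\<bar>v k\<bar> \<le> x h" if k: "k \<in> {- int h..int h}" for k
          proof -
            have "(\<lambda>l. of_bool (l = k)) \<in> test_weights h (K h)" using k by (auto simp: test_weights_def)
            from small[OF this] show ?thesis using k by (simp add: sum.remove[of "{- int h..int h}" k])
          qed
        qed (rule small, force simp: test_weights_def)+
        also have "\<dots> \<le> (sqrt 2 + 5 / real L) * x h"
        proof (intro mult_right_mono x add_left_mono)
          have "(2 * real h + 1) * real h * (2 * pi / real (K h)) = (2 * real h + 1) / (2 * real h) * (pi / real L)"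
            using h L by (simp add: K_def field_simps power2_eq_square)
          also have "\<dots> \<le> 3 / 2 * (10 / 3 / real L)"
          proof (intro mult_mono divide_right_mono)
            show "(2 * real h + 1) / (2 * real h) \<le> 3 / 2" using h by (simp add: field_simps)
            show "pi \<le> 10 / 3" using pi_approx by simp
          qed auto
          finally show "(2 * real h + 1) * real h * (2 * pi / real (K h)) \<le> 5 / real L" by simp
        qed
        also have "\<dots> = (4 * (sqrt 2 + 5 / real L) * \<sigma>) * sqrt (2 * real h * ln (2 * real h))"
          by (simp only: x_def mult_ac)
        finally show ?thesis using norm_pos by (simp only: pos_divide_le_eq)
      qed
      then show ?case by (simp add: Let_def SUP_le_iff)
    qed
    then show ?case by (rule Limsup_bounded)
  qed
qed

theorem theorem3:
  fixes M :: "'w measure"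
    and X :: "int \<Rightarrow> 'w \<Rightarrow> real"
    and F :: "(real \<times> real) set \<Rightarrow> complex"
    and f :: "real \<Rightarrow> real \<Rightarrow> complex"
    and c :: "int \<Rightarrow> real"
  assumes prob: "prob_space M"
    and mean_zero: "mean_zero M X"
    and harmonizable: "harmonizable M X F"
    and almost_periodic: "almost_periodic_covariance M X"
    and densities: "has_line_densities F f"
    and gaussian: "gaussian_process M X"
    and finite_lines: "finite (spectral_lines f)"
    and smooth: "\<And>b. b \<in> spectral_lines f \<Longrightarrow> C1_on_torus (f b)"
    and c_nonneg: "\<And>j. 0 \<le> c j"
    and dominated: "\<And>b j. b \<in> spectral_lines f \<Longrightarrow> cmod (line_coeff f b j) \<le> c j"
    and summable: "c summable_on UNIV"
  shows "AE \<omega> in M.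
    limsup (\<lambda>h :: nat. let n = 2 * h in
        SUP w :: real. ereal (cmod (V M X n w \<omega>) / sqrt (real n * ln (real n))))
      \<le> ereal (2 powr (5 / 2) * real (card (spectral_lines f)) * (\<Sum>\<^sub>\<infinity>j. c j))"
proof -
  interpret prob_space M by (rule prob)
  have X: "X k \<in> borel_measurable M" "integrable M (\<lambda>\<omega>. (X k \<omega>)\<^sup>2)" for k
    using harmonizable unfolding harmonizable_def by blast+
  define S where "S = real (card (spectral_lines f)) * (\<Sum>\<^sub>\<infinity>j. c j)"
  have S: "0 \<le> S" using c_nonneg by (simp add: S_def infsum_nonneg)
  have row: "(\<Sum>m\<in>I. \<bar>covariance M X k m\<bar>) \<le> S + 1 / real (Suc l)" if "finite I" for I k l
    using covariance_row_sum_le[OF harmonizable densities finite_lines c_nonneg dominated summable that, of k]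
    by (simp add: S_def add_increasing2)
  let ?Q = "\<lambda>\<omega>. limsup (\<lambda>h :: nat. let n = 2 * h in
        SUP w :: real. ereal (cmod (V M X n w \<omega>) / sqrt (real n * ln (real n))))"
  \<comment> \<open>One sequence serves both limits: \<open>L = l + 1\<close> and \<open>\<sigma> = S + 1 / (l + 1)\<close>, which is positive even if \<open>S = 0\<close>.\<close>
  have "AE \<omega> in M. \<forall>l. ?Q \<omega> \<le> ereal (4 * (sqrt 2 + 5 / real (Suc l)) * (S + 1 / real (Suc l)))"
    unfolding AE_all_countable
    using S by (intro allI limsup_sup_V_le X row char_gaussian_process[OF mean_zero gaussian X]) (auto intro: add_nonneg_pos)
  then show ?thesis
  proof eventually_elim
    case (elim \<omega>)
    have "(\<lambda>l. 4 * (sqrt 2 + 5 / real (Suc l)) * (S + 1 / real (Suc l))) \<longlonglongrightarrow> 4 * (sqrt 2 + 0) * (S + 0)"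
      by (intro tendsto_intros lim_const_over_n[THEN LIMSEQ_Suc])
    then have "(\<lambda>l. ereal (4 * (sqrt 2 + 5 / real (Suc l)) * (S + 1 / real (Suc l)))) \<longlonglongrightarrow> ereal (4 * sqrt 2 * S)"
      by simp
    then have "?Q \<omega> \<le> ereal (4 * sqrt 2 * S)"
      by (rule LIMSEQ_le_const) (use elim in blast)
    also have "4 * sqrt 2 * S = 2 powr (5 / 2) * real (card (spectral_lines f)) * (\<Sum>\<^sub>\<infinity>j. c j)"
    proof -
      have "(2::real) powr (5 / 2) = 2 powr (2 + 1 / 2)" by simp
      also have "\<dots> = 2 powr 2 * 2 powr (1 / 2)" by (rule powr_add)
      also have "\<dots> = 4 * sqrt 2" by (simp add: powr_half_sqrt)
      finally show ?thesis by (simp add: S_def)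
    qed
    finally show ?case .
  qed
qed

end
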